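(* Let $\mathcal{CL}=\{\ell_1,\dots,\ell_n,C_1,\dots,C_k\}\subset\mathbb{P}^2_{\mathbb{C}}$ be a conic-line arrangement, with $n\geq 1$ lines and $k\geq 1$ conics. Let $H$ be its Levi graph, $S_H=\mathbb{K}[a_v,b_v:v\in V(H)]$ over a field $\mathbb{K}$, and $J_H$ the binomial edge ideal of $H$. Then $S_H/J_H$ is not Cohen–Macaulay.
   Context: A conic-line arrangement $\mathcal{CL}=\{\ell_1,\dots,\ell_n,C_1,\dots,C_k\}$ is an arrangement of $n$ lines and $k$ smooth conics in $\mathbb{P}^2_{\mathbb{C}}$ having only ordinary singularities, i.e. every intersection point looks locally like $\{x^a=y^a\}$ for some integer $a\geq 2$. Its Levi graph $H$ is the bipartite graph with one vertex for each point $p\in\mathrm{Sing}(\mathcal{CL})$, one vertex for each line $\ell_j$ and for each conic $C_j$, and an edge between the vertex of $p$ and the vertex of a curve iff $p$ lies on that curve. For a graph with vertices labelled $1,\dots,m$, the binomial edge ideal $J\subseteq \mathbb{K}[a_1,\dots,a_m,b_1,\dots,b_m]$ is generated by $a_ib_j-a_jb_i$ for all edges $\{i,j\}$ with $i<j$. *)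

theory Defs
  imports "HOL-Analysis.Analysis" "HOL-Algebra.Ideal" "HOL-Library.Poly_Mapping"
begin

text \<open>Points of P^2(C) are represented by nonzero vectors of complex^3; the projective
point of p is its set of nonzero scalar multiples.  Lines are given by nonzero linear forms
(coefficient vectors), conics by symmetric 3x3 matrices (quadratic form p^T A p).\<close>

definition cdot :: "complex^3 \<Rightarrow> complex^3 \<Rightarrow> complex" where
  "cdot x y = (\<Sum>i\<in>UNIV. x $ i * y $ i)"

definition proj_pt :: "complex^3 \<Rightarrow> (complex^3) set" where
  "proj_pt p = {c *s p | c. c \<noteq> 0}"

definition curve_eq :: "nat \<Rightarrow> (nat \<Rightarrow> complex^3) \<Rightarrow> (nat \<Rightarrow> complex^3^3) \<Rightarrow> nat \<Rightarrow> complex^3 \<Rightarrow> bool" where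
  "curve_eq n L A j p = (if j < n then cdot (L j) p = 0 else cdot p (A (j - n) *v p) = 0)"

text \<open>A vector normal to the tangent line (the gradient, up to the factor 2 for conics).\<close>
definition curve_grad :: "nat \<Rightarrow> (nat \<Rightarrow> complex^3) \<Rightarrow> (nat \<Rightarrow> complex^3^3) \<Rightarrow> nat \<Rightarrow> complex^3 \<Rightarrow> complex^3" where
  "curve_grad n L A j p = (if j < n then L j else A (j - n) *v p)"

definition curve_zero_set :: "nat \<Rightarrow> (nat \<Rightarrow> complex^3) \<Rightarrow> (nat \<Rightarrow> complex^3^3) \<Rightarrow> nat \<Rightarrow> (complex^3) set" where
  "curve_zero_set n L A j = {p. p \<noteq> 0 \<and> curve_eq n L A j p}"

text \<open>Smooth conic: symmetric quadratic form whose zero locus has no singular point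
(the gradient 2 A p never vanishes at a point of the conic).\<close>
definition smooth_conic :: "complex^3^3 \<Rightarrow> bool" where
  "smooth_conic A \<longleftrightarrow> transpose A = A \<and> (\<forall>p. p \<noteq> 0 \<and> cdot p (A *v p) = 0 \<longrightarrow> A *v p \<noteq> 0)"

text \<open>Conic-line arrangement with only ordinary singularities: n lines, k smooth conics,
all curves distinct, and at every common point of two distinct curves of the arrangement
their tangent lines are distinct (since all curves are smooth, this is exactly the condition
that every singular point is locally a union of smooth branches with pairwise distinct
tangents, i.e. locally x^a = y^a).\<close>
definition conic_line_arrangement :: "nat \<Rightarrow> nat \<Rightarrow> (nat \<Rightarrow> complex^3) \<Rightarrow> (nat \<Rightarrow> complex^3^3) \<Rightarrow> bool" where
  "conic_line_arrangement n k L A \<longleftrightarrow>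
     (\<forall>j<n. L j \<noteq> 0) \<and>
     (\<forall>j<k. smooth_conic (A j)) \<and>
     (\<forall>i<n+k. \<forall>j<n+k. i \<noteq> j \<longrightarrow> curve_zero_set n L A i \<noteq> curve_zero_set n L A j) \<and>
     (\<forall>p i j. p \<noteq> 0 \<and> i < n+k \<and> j < n+k \<and> i \<noteq> j \<and> curve_eq n L A i p \<and> curve_eq n L A j p
        \<longrightarrow> (\<forall>c. curve_grad n L A i p \<noteq> c *s curve_grad n L A j p))"

definition sing_points :: "nat \<Rightarrow> nat \<Rightarrow> (nat \<Rightarrow> complex^3) \<Rightarrow> (nat \<Rightarrow> complex^3^3) \<Rightarrow> (complex^3) set set" where
  "sing_points n k L A = {proj_pt p | p. p \<noteq> 0 \<and>
      (\<exists>i j. i < n+k \<and> j < n+k \<and> i \<noteq> j \<and> curve_eq n L A i p \<and> curve_eq n L A j p)}"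

type_synonym levi_vertex = "(complex^3) set + nat"

definition levi_vertices :: "nat \<Rightarrow> nat \<Rightarrow> (nat \<Rightarrow> complex^3) \<Rightarrow> (nat \<Rightarrow> complex^3^3) \<Rightarrow> levi_vertex set" where
  "levi_vertices n k L A = Inl ` sing_points n k L A \<union> Inr ` {..<n+k}"

definition levi_edge :: "nat \<Rightarrow> nat \<Rightarrow> (nat \<Rightarrow> complex^3) \<Rightarrow> (nat \<Rightarrow> complex^3^3) \<Rightarrow> levi_vertex \<Rightarrow> levi_vertex \<Rightarrow> bool" where
  "levi_edge n k L A u v \<longleftrightarrow>
     (\<exists>P j. P \<in> sing_points n k L A \<and> j < n+k \<and> (\<exists>p\<in>P. curve_eq n L A j p) \<and>
        ((u = Inl P \<and> v = Inr j) \<or> (u = Inr j \<and> v = Inl P)))"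

text \<open>Polynomials over 'k in variables indexed by 'v \<times> bool: (v,True) is a_v, (v,False) is b_v.\<close>
type_synonym ('v,'k) mpoly = "(('v \<times> bool) \<Rightarrow>\<^sub>0 nat) \<Rightarrow>\<^sub>0 'k"

definition pvar :: "'x \<Rightarrow> (('x \<Rightarrow>\<^sub>0 nat) \<Rightarrow>\<^sub>0 'k::comm_ring_1)" where
  "pvar x = Poly_Mapping.single (Poly_Mapping.single x 1) 1"

definition var_a :: "'v \<Rightarrow> ('v,'k::comm_ring_1) mpoly" where "var_a v = pvar (v, True)"
definition var_b :: "'v \<Rightarrow> ('v,'k::comm_ring_1) mpoly" where "var_b v = pvar (v, False)"

definition poly_ring :: "'v set \<Rightarrow> ('v,'k::field) mpoly ring" where
  "poly_ring V = \<lparr>carrier = {f. \<forall>m \<in> Poly_Mapping.keys f. \<forall>x \<in> Poly_Mapping.keys m. fst x \<in> V},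
                  monoid.mult = (*), one = 1, zero = 0, add = (+)\<rparr>"

definition binomial_edge_ideal :: "'v set \<Rightarrow> ('v \<Rightarrow> 'v \<Rightarrow> bool) \<Rightarrow> ('v,'k::field) mpoly set" where
  "binomial_edge_ideal V E = genideal (poly_ring V)
     {var_a u * var_b v - var_a v * var_b u | u v. u \<in> V \<and> v \<in> V \<and> E u v}"

definition irrelevant_ideal :: "'v set \<Rightarrow> ('v,'k::field) mpoly set" where
  "irrelevant_ideal V = genideal (poly_ring V) ({var_a v | v. v \<in> V} \<union> {var_b v | v. v \<in> V})"

definition krull_dim_quot :: "('a, 'm) ring_scheme \<Rightarrow> 'a set \<Rightarrow> enat" where
  "krull_dim_quot R I = Sup {enat r | r. \<exists>P :: nat \<Rightarrow> 'a set.
      (\<forall>i\<le>r. primeideal (P i) R \<and> I \<subseteq> P i) \<and> (\<forall>i<r. P i \<subset> P (Suc i))}"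

definition depth_quot :: "('a, 'm) ring_scheme \<Rightarrow> 'a set \<Rightarrow> 'a set \<Rightarrow> enat" where
  "depth_quot R M I = Sup {enat r | r. \<exists>f :: nat \<Rightarrow> 'a.
      (\<forall>i<r. f i \<in> M) \<and>
      (\<forall>i<r. \<forall>g \<in> carrier R. f i \<otimes>\<^bsub>R\<^esub> g \<in> genideal R (I \<union> f ` {..<i}) \<longrightarrow> g \<in> genideal R (I \<union> f ` {..<i})) \<and>
      genideal R (I \<union> f ` {..<r}) \<noteq> carrier R}"

text \<open>S_V / I (I a homogeneous ideal) is Cohen--Macaulay iff depth with respect to the
irrelevant ideal equals the Krull dimension.\<close>
definition cohen_macaulay_quot :: "'v set \<Rightarrow> ('v,'k::field) mpoly set \<Rightarrow> bool" where
  "cohen_macaulay_quot V I \<longleftrightarrow>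
     depth_quot (poly_ring V) (irrelevant_ideal V) I = krull_dim_quot (poly_ring V) I"

end

theory Submission
  imports Defs
begin

text \<open>Let \<open>m\<close> be the number of curves and \<open>s\<close> the number of singular points. Every singular point lies
on two curves, and every curve contains two singular points because a line and a conic without
common tangent meet twice. Hence the primes generated by the variables of all points, resp. of all
curves, are of the form \<open>(J : h)\<close>, with quotients of dimension \<open>2m\<close>, resp. \<open>2s\<close>, and the depth is at
most \<open>2 min(m, s)\<close>. But \<open>J\<close> lies in the determinantal ideal of the 2-minors of a generic
\<open>2 \<times> (m + s)\<close> matrix, so the dimension is at least \<open>m + s + 1\<close>. Finiteness of the set of points is
not assumed: if it is infinite, the bound \<open>2m\<close> is used and the chain of primes is taken on finitely
many vertices.\<close>

section \<open>Ideals and regular sequences in a subring\<close>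

text \<open>That depth is at most the dimension of an associated prime is proved by counting. If U
  is one side of the bipartition and r > 2|U|, products of powers of r elements eventually outnumber
  the monomials in the 2|U| variables of U. Some combination of them therefore lies in the prime of
  the remaining variables and sends h into J. Replacing the r elements by their t-th powers, with t
  beyond the degree of h, turns the resulting membership of h into a contradiction of degrees; this
  does the work of Krull's intersection theorem.

  The witness h is the product of the minors D_ij over all pairs in U. If v outside U has two
  neighbours i, j in U, then x_v D_ij = x_i D_vj - x_j D_vi lies in J for x = a and x = b; this is
  why each vertex needs two neighbours. Sending a to 1 and the b_i to independent variables turns h
  into a product of differences, so h stays outside the prime.

  Since 2 min(m, s) <= m + s < m + s + 1 for all m and s, the proof only has to ask which side of
  the Levi graph is smaller.\<close>

fun power_prod :: "nat \<Rightarrow> 'a::comm_ring_1 list \<Rightarrow> nat list \<Rightarrow> 'a" where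
  "power_prod t (x # xs) (e # es) = (x ^ t) ^ e * power_prod t xs es" |
  "power_prod t _ _ = 1"

text \<open>The rings \<open>poly_ring V\<close> for all \<open>V\<close> live in one polynomial
  type. Working in a subset \<open>C\<close> closed under its operations keeps class-based
  arithmetic available, and \<open>as_ring\<close> is the bridge to the record-based notions of the
  definitions.\<close>

locale subring_set =
  fixes C :: "'a::comm_ring_1 set"
  assumes zero_closed [simp, intro]: "0 \<in> C" and one_closed [simp, intro]: "1 \<in> C"
    and add_closed [intro]: "a \<in> C \<Longrightarrow> b \<in> C \<Longrightarrow> a + b \<in> C"
    and mult_closed [intro]: "a \<in> C \<Longrightarrow> b \<in> C \<Longrightarrow> a * b \<in> C"
    and uminus_closed [intro]: "a \<in> C \<Longrightarrow> - a \<in> C"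
begin

lemma diff_closed [intro]: "a \<in> C \<Longrightarrow> b \<in> C \<Longrightarrow> a - b \<in> C"
  using add_closed[of a "- b"] uminus_closed[of b] by simp

lemma power_closed [intro]: "a \<in> C \<Longrightarrow> a ^ j \<in> C"
  by (induction j) auto

lemma sum_closed: "(\<And>a. a \<in> S \<Longrightarrow> f a \<in> C) \<Longrightarrow> sum f S \<in> C"
  by (induction S rule: infinite_finite_induct) auto

lemma prod_closed: "(\<And>a. a \<in> S \<Longrightarrow> f a \<in> C) \<Longrightarrow> prod f S \<in> C"
  by (induction S rule: infinite_finite_induct) auto

definition as_ring :: "'a ring" where
  "as_ring = \<lparr>carrier = C, monoid.mult = (*), one = 1, zero = 0, add = (+)\<rparr>"

lemma as_ring_simps [simp]:
  "carrier as_ring = C" "a \<otimes>\<^bsub>as_ring\<^esub> b = a * b" "\<one>\<^bsub>as_ring\<^esub> = 1"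
  "\<zero>\<^bsub>as_ring\<^esub> = 0" "a \<oplus>\<^bsub>as_ring\<^esub> b = a + b"
  by (simp_all add: as_ring_def)

lemma cring_as_ring: "cring as_ring"
proof (rule cringI)
  show "abelian_group as_ring"
    by (rule abelian_groupI) (auto simp: algebra_simps intro: bexI[of _ "- x" for x])
  show "comm_monoid as_ring"
    by (rule comm_monoidI) (auto simp: algebra_simps)
qed (auto simp: algebra_simps)

lemma ring_as_ring: "ring as_ring"
  using cring_as_ring by (simp add: cring_def)

definition is_ideal :: "'a set \<Rightarrow> bool" where
  "is_ideal I \<longleftrightarrow> I \<subseteq> C \<and> 0 \<in> I \<and> (\<forall>a\<in>I. \<forall>b\<in>I. a + b \<in> I) \<and> (\<forall>c\<in>C. \<forall>a\<in>I. c * a \<in> I)"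

lemma is_idealD:
  assumes "is_ideal I"
  shows "a \<in> I \<Longrightarrow> a \<in> C" "0 \<in> I" "a \<in> I \<Longrightarrow> b \<in> I \<Longrightarrow> a + b \<in> I"
    "c \<in> C \<Longrightarrow> a \<in> I \<Longrightarrow> c * a \<in> I" "a \<in> I \<Longrightarrow> - a \<in> I" "a \<in> I \<Longrightarrow> b \<in> I \<Longrightarrow> a - b \<in> I"
proof -
  show *: "a \<in> I \<Longrightarrow> a \<in> C" "0 \<in> I" "\<And>a b. a \<in> I \<Longrightarrow> b \<in> I \<Longrightarrow> a + b \<in> I"
    "\<And>c a. c \<in> C \<Longrightarrow> a \<in> I \<Longrightarrow> c * a \<in> I" for a
    using assms by (auto simp: is_ideal_def)
  show **: "a \<in> I \<Longrightarrow> - a \<in> I" for a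
    using *(4)[of "-1" a] by auto
  show "a \<in> I \<Longrightarrow> b \<in> I \<Longrightarrow> a - b \<in> I"
    using *(3)[of a "- b"] **[of b] by simp
qed

lemma is_ideal_sum: "is_ideal I \<Longrightarrow> (\<And>a. a \<in> S \<Longrightarrow> f a \<in> I) \<Longrightarrow> sum f S \<in> I"
  by (induction S rule: infinite_finite_induct) (auto simp: is_idealD)

lemma ideal_iff_is_ideal: "ideal I as_ring \<longleftrightarrow> is_ideal I"
proof
  assume "ideal I as_ring"
  then interpret ideal I as_ring .
  show "is_ideal I"
    unfolding is_ideal_def
  proof (intro conjI ballI)
    show "I \<subseteq> C" using a_subset by simp
    show "0 \<in> I" using additive_subgroup.zero_closed[OF additive_subgroup_axioms] by simp
    show "a + b \<in> I" if "a \<in> I" "b \<in> I" for a b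
      using additive_subgroup.a_closed[OF additive_subgroup_axioms that] by simp
    show "c * a \<in> I" if "c \<in> C" "a \<in> I" for a c
      using I_l_closed[of a c] that by simp
  qed
next
  assume I: "is_ideal I"
  interpret R: cring as_ring by (rule cring_as_ring)
  show "ideal I as_ring"
  proof (rule idealI)
    have neg: "inv\<^bsub>add_monoid as_ring\<^esub> a = - a" if "a \<in> C" for a
      using R.minus_equality[of "- a" a] that by (auto simp: a_inv_def)
    show "subgroup I (add_monoid as_ring)"
    proof (rule subgroup.intro)
      show "inv\<^bsub>add_monoid as_ring\<^esub> a \<in> I" if "a \<in> I" for a
        using that I by (simp only: neg is_idealD)
    qed (use I in \<open>auto simp: is_idealD\<close>)
    show "x \<otimes>\<^bsub>as_ring\<^esub> a \<in> I" "a \<otimes>\<^bsub>as_ring\<^esub> x \<in> I" if "a \<in> I" "x \<in> carrier as_ring" for a x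
      using is_idealD(4)[OF I, of x a] that by (simp_all add: mult.commute)
  qed (rule R.ring_axioms)
qed

definition gen :: "'a set \<Rightarrow> 'a set" where "gen X = genideal as_ring X"

lemma gen_ideal: "X \<subseteq> C \<Longrightarrow> is_ideal (gen X)"
  using ring.genideal_ideal[OF ring_as_ring] by (simp add: gen_def ideal_iff_is_ideal)

lemma gen_superset: "X \<subseteq> C \<Longrightarrow> X \<subseteq> gen X"
  using ring.genideal_self[OF ring_as_ring] by (simp add: gen_def)

lemma gen_minimal: "is_ideal I \<Longrightarrow> X \<subseteq> I \<Longrightarrow> gen X \<subseteq> I"
  using ring.genideal_minimal[OF ring_as_ring] by (simp add: gen_def ideal_iff_is_ideal)

lemma gen_of_ideal: "is_ideal I \<Longrightarrow> gen I = I"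
  using gen_minimal[of I I] gen_superset[of I] by (auto simp: is_ideal_def)

definition ext :: "'a set \<Rightarrow> 'a \<Rightarrow> 'a set" where
  "ext I x = {a + x * c | a c. a \<in> I \<and> c \<in> C}"

lemma extI: "a \<in> I \<Longrightarrow> c \<in> C \<Longrightarrow> a + x * c \<in> ext I x"
  by (auto simp: ext_def)

lemma extE:
  assumes "y \<in> ext I x" obtains a c where "a \<in> I" "c \<in> C" "y = a + x * c"
  using assms by (auto simp: ext_def)

lemma ext_superset: "I \<subseteq> ext I x"
  using extI[of _ I 0 x] by fastforce

lemma ext_ideal:
  assumes I: "is_ideal I" and x: "x \<in> C"
  shows "is_ideal (ext I x)"
  unfolding is_ideal_def
proof (intro conjI ballI subsetI)
  fix y assume "y \<in> ext I x" then show "y \<in> C"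
    using I x by (auto elim!: extE simp: is_idealD)
next
  show "0 \<in> ext I x" using ext_superset is_idealD(2)[OF I] by auto
next
  fix y z assume "y \<in> ext I x" "z \<in> ext I x"
  then obtain a c a' c' where "a \<in> I" "c \<in> C" "y = a + x * c" "a' \<in> I" "c' \<in> C" "z = a' + x * c'"
    by (metis extE)
  then show "y + z \<in> ext I x"
    using extI[of "a + a'" I "c + c'" x] I by (auto simp: is_idealD algebra_simps)
next
  fix d y assume d: "d \<in> C" and "y \<in> ext I x"
  then obtain a c where "a \<in> I" "c \<in> C" "y = a + x * c" by (metis extE)
  then show "d * y \<in> ext I x"
    using extI[of "d * a" I "d * c" x] is_idealD(4)[OF I d] d by (auto simp: distrib_left mult.left_commute)
qed

lemma ext_minimal: "is_ideal K \<Longrightarrow> I \<subseteq> K \<Longrightarrow> x \<in> K \<Longrightarrow> ext I x \<subseteq> K"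
  by (auto simp: ext_def is_idealD mult.commute[of x])

lemma ext_commute: "ext (ext I x) y = ext (ext I y) x"
proof -
  have "ext (ext I x) y \<subseteq> ext (ext I y) x" for x y
  proof
    fix z assume "z \<in> ext (ext I x) y"
    then obtain a c d where "a \<in> I" "c \<in> C" "d \<in> C" "z = a + x * c + y * d" by (metis extE)
    then show "z \<in> ext (ext I y) x"
      using extI[OF extI[of a I d y], of c x] by (simp add: algebra_simps)
  qed
  then show ?thesis by blast
qed

lemma gen_insert:
  assumes I: "is_ideal I" and x: "x \<in> C" and X: "X \<subseteq> C"
  shows "gen (I \<union> insert x X) = ext (gen (I \<union> X)) x"
proof
  have IX: "I \<union> X \<subseteq> C" and IxX: "I \<union> insert x X \<subseteq> C" using I x X by (auto simp: is_ideal_def)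
  have x_in: "x \<in> ext (gen (I \<union> X)) x"
    using extI[OF is_idealD(2)[OF gen_ideal[OF IX]], of 1 x] by simp
  show "gen (I \<union> insert x X) \<subseteq> ext (gen (I \<union> X)) x"
    using gen_superset[OF IX] ext_superset[of "gen (I \<union> X)" x] x_in
    by (intro gen_minimal ext_ideal gen_ideal IX x) blast
  show "ext (gen (I \<union> X)) x \<subseteq> gen (I \<union> insert x X)"
    using gen_superset[OF IxX] by (intro ext_minimal gen_minimal gen_ideal IxX) auto
qed

section \<open>Regular sequences and relations among powers of their elements\<close>

fun exts :: "'a set \<Rightarrow> 'a list \<Rightarrow> 'a set" where
  "exts I [] = I" |
  "exts I (x # xs) = exts (ext I x) xs"

fun regular :: "'a set \<Rightarrow> 'a list \<Rightarrow> bool" where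
  "regular I [] \<longleftrightarrow> True" |
  "regular I (x # xs) \<longleftrightarrow> (\<forall>g\<in>C. x * g \<in> I \<longrightarrow> g \<in> I) \<and> regular (ext I x) xs"

lemma exts_append: "exts I (xs @ [x]) = ext (exts I xs) x"
  by (induction xs arbitrary: I) auto

lemma regular_append:
  "regular I (xs @ [x]) \<longleftrightarrow> regular I xs \<and> (\<forall>g\<in>C. x * g \<in> exts I xs \<longrightarrow> g \<in> exts I xs)"
  by (induction xs arbitrary: I) auto

lemma exts_minimal:
  "is_ideal K \<Longrightarrow> I \<subseteq> K \<Longrightarrow> set xs \<subseteq> K \<Longrightarrow> exts I xs \<subseteq> K"
  by (induction xs arbitrary: I) (auto simp: ext_minimal)

lemma gen_eq_exts:
  assumes I: "is_ideal I" and "\<And>i. i < r \<Longrightarrow> f i \<in> C"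
  shows "gen (I \<union> f ` {..<r}) = exts I (map f [0..<r])"
  using assms(2)
proof (induction r)
  case 0
  then show ?case using gen_of_ideal[OF I] by simp
next
  case (Suc r)
  have "gen (I \<union> f ` {..<Suc r}) = gen (I \<union> insert (f r) (f ` {..<r}))"
    by (simp add: lessThan_Suc)
  also have "\<dots> = ext (gen (I \<union> f ` {..<r})) (f r)"
    using Suc.prems by (intro gen_insert I) auto
  finally show ?case using Suc by (simp add: exts_append)
qed

lemma regular_if_depth_seq:
  assumes I: "is_ideal I" and f: "\<And>i. i < r \<Longrightarrow> f i \<in> C"
    and reg: "\<And>i g. i < r \<Longrightarrow> g \<in> C \<Longrightarrow> f i * g \<in> gen (I \<union> f ` {..<i}) \<Longrightarrow> g \<in> gen (I \<union> f ` {..<i})"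
  shows "regular I (map f [0..<r])"
  using f reg
proof (induction r)
  case (Suc r)
  have "gen (I \<union> f ` {..<r}) = exts I (map f [0..<r])"
    using Suc.prems(1) by (intro gen_eq_exts I) auto
  with Suc show ?case by (auto simp: regular_append)
qed simp

text \<open>The hypotheses say that multiplication by \<open>u\<close> induces an exact sequence
  \<open>0 \<rightarrow> C/I1 \<rightarrow> C/K \<rightarrow> C/I \<rightarrow> 0\<close>; a sequence regular on both ends is regular in the middle.\<close>

lemma regular_extension:
  assumes "is_ideal I1" "is_ideal K" "u \<in> C" "set xs \<subseteq> C"
    and I: "I = ext K u"
    and u: "\<And>a. a \<in> C \<Longrightarrow> u * a \<in> K \<longleftrightarrow> a \<in> I1"
    and "regular I1 xs" "regular I xs"
  shows "regular K xs"
  using assms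
proof (induction xs arbitrary: I1 I K)
  case (Cons y xs)
  have y: "y \<in> C" and K: "is_ideal K" and I1: "is_ideal I1" and uC: "u \<in> C"
    using Cons.prems by auto
  have I_ideal: "is_ideal I" using Cons.prems by (simp add: ext_ideal)
  note u = Cons.prems(6)
  have KI: "K \<subseteq> I" using Cons.prems by (simp add: ext_superset)
  have reg_I1: "a \<in> I1" if "a \<in> C" "y * a \<in> I1" for a
    using Cons.prems(7) that by simp
  have reg_I: "a \<in> I" if "a \<in> C" "y * a \<in> I" for a
    using Cons.prems(8) that by simp
  have uI: "u * a \<in> I" if "a \<in> C" for a
    using extI[OF is_idealD(2)[OF K] that, of u] Cons.prems(5) by simp
  have "g \<in> K" if g: "g \<in> C" "y * g \<in> K" for g
  proof -
    have "g \<in> I" using reg_I g KI by blast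
    then obtain i a where i: "i \<in> K" "a \<in> C" "g = i + u * a" using Cons.prems(5) by (metis extE)
    have "u * (y * a) = y * g - y * i" using i by (simp add: algebra_simps)
    also have "\<dots> \<in> K" using K g i y by (simp add: is_idealD)
    finally have "a \<in> I1" using u[of "y * a"] reg_I1 i y by auto
    then show "g \<in> K" using u i K by (auto simp: is_idealD)
  qed
  moreover have "regular (ext K y) xs"
  proof (rule Cons.IH)
    show "is_ideal (ext I1 y)" "is_ideal (ext K y)" "u \<in> C" "set xs \<subseteq> C"
      using Cons.prems by (auto simp: ext_ideal)
    show "ext I y = ext (ext K y) u" using Cons.prems(5) ext_commute by simp
    show "regular (ext I1 y) xs" "regular (ext I y) xs" using Cons.prems by auto
    fix a assume a: "a \<in> C"
    show "u * a \<in> ext K y \<longleftrightarrow> a \<in> ext I1 y"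
    proof
      assume "u * a \<in> ext K y"
      then obtain i c where i: "i \<in> K" "c \<in> C" "u * a = i + y * c" by (metis extE)
      \<comment> \<open>Regularity of \<open>y\<close> modulo \<open>I\<close> puts the cofactor
        \<open>c\<close> into \<open>I\<close>, that is, into K + (u). Its \<open>u\<close>-part can
        then be subtracted from \<open>a\<close>, which is why exactness survives reduction modulo
        \<open>y\<close>.\<close>
      have "y * c = u * a - i" using i by simp
      also have "\<dots> \<in> I" using i KI uI[OF a] I_ideal by (blast intro: is_idealD)
      finally have "c \<in> I" using reg_I i by blast
      then obtain j c' where j: "j \<in> K" "c' \<in> C" "c = j + u * c'" using Cons.prems(5) by (metis extE)
      have "u * (a - y * c') = i + y * j" using i j by (simp add: algebra_simps)
      also have "\<dots> \<in> K" using i j y K by (simp add: is_idealD)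
      finally have "a - y * c' \<in> I1" using u[of "a - y * c'"] a j y by auto
      then show "a \<in> ext I1 y" using extI[of "a - y * c'" I1 c' y] j by simp
    next
      assume "a \<in> ext I1 y"
      then obtain i c where i: "i \<in> I1" "c \<in> C" "a = i + y * c" by (metis extE)
      then have "u * i \<in> K" using u I1 by (simp add: is_idealD)
      then show "u * a \<in> ext K y"
        using extI[of "u * i" K "u * c" y] i uC by (auto simp: algebra_simps)
    qed
  qed
  ultimately show ?case by simp
qed simp

lemma regular_element_power:
  assumes "is_ideal I" "x \<in> C" "\<And>g. g \<in> C \<Longrightarrow> x * g \<in> I \<Longrightarrow> g \<in> I"
  shows "g \<in> C \<Longrightarrow> x ^ j * g \<in> I \<Longrightarrow> g \<in> I"
proof (induction j)
  case (Suc j)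
  then have "x * (x ^ j * g) \<in> I" "x ^ j * g \<in> C" using assms(2) by (auto simp: mult.assoc)
  with Suc assms(3) show ?case by blast
qed simp

text \<open>Multiplication by \<open>x ^ Suc t\<close> embeds C/(I + (x)) into C/(I +
  (\<open>x ^ Suc (Suc t)\<close>)) with cokernel C/(I + (\<open>x ^ Suc t\<close>)), so
  \<open>regular_extension\<close> gives the induction step.\<close>

lemma regular_ext_power:
  assumes I: "is_ideal I" and x: "x \<in> C" and xs: "set xs \<subseteq> C" and reg: "regular I (x # xs)"
  shows "regular (ext I (x ^ Suc t)) xs"
proof (induction t)
  case 0
  then show ?case using reg by simp
next
  case (Suc t)
  let ?u = "x ^ Suc t"
  have x_reg: "g \<in> I" if "g \<in> C" "?u * g \<in> I" for g
    using regular_element_power[OF I x _ that] reg by auto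
  show ?case
  proof (rule regular_extension[where ?I1.0 = "ext I x" and I = "ext I ?u" and u = ?u])
    show "is_ideal (ext I x)" "is_ideal (ext I (x ^ Suc (Suc t)))" "?u \<in> C"
      using x I by (auto intro!: ext_ideal)
    have id: "is_ideal (ext I ?u)" using I x by (auto intro!: ext_ideal)
    show "ext I ?u = ext (ext I (x ^ Suc (Suc t))) ?u"
    proof (intro equalityI ext_minimal)
      have *: "?u \<in> ext I ?u" using extI[OF is_idealD(2)[OF I], of 1 ?u] by simp
      show "is_ideal (ext I ?u)" "?u \<in> ext I ?u" "I \<subseteq> ext I ?u"
        using id * ext_superset by auto
      show "x ^ Suc (Suc t) \<in> ext I ?u" using is_idealD(4)[OF id x *] by simp
      show K: "is_ideal (ext (ext I (x ^ Suc (Suc t))) ?u)"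
        using x I by (intro ext_ideal) auto
      show "I \<subseteq> ext (ext I (x ^ Suc (Suc t))) ?u" using ext_superset by blast
      show "?u \<in> ext (ext I (x ^ Suc (Suc t))) ?u"
        using extI[of 0 "ext I (x ^ Suc (Suc t))" 1 ?u] ext_superset is_idealD(2)[OF I] by auto
    qed (rule id)
    fix a assume a: "a \<in> C"
    show "?u * a \<in> ext I (x ^ Suc (Suc t)) \<longleftrightarrow> a \<in> ext I x"
    proof
      assume "?u * a \<in> ext I (x ^ Suc (Suc t))"
      then obtain i c where i: "i \<in> I" "c \<in> C" "?u * a = i + x ^ Suc (Suc t) * c" by (metis extE)
      then have "?u * (a - x * c) = i" by (simp add: algebra_simps)
      then have "a - x * c \<in> I" using x_reg[of "a - x * c"] i a x by auto
      then show "a \<in> ext I x" using extI[of "a - x * c" I c x] i by simp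
    next
      assume "a \<in> ext I x"
      then obtain i c where i: "i \<in> I" "c \<in> C" "a = i + x * c" by (metis extE)
      then show "?u * a \<in> ext I (x ^ Suc (Suc t))"
        using extI[of "?u * i" I c "x ^ Suc (Suc t)"] is_idealD(4)[OF I _ i(1), of ?u] x
        by (auto simp: algebra_simps)
    qed
  qed (use reg Suc xs in auto)
qed

lemma power_prod_closed: "set xs \<subseteq> C \<Longrightarrow> power_prod t xs es \<in> C"
  by (induction t xs es rule: power_prod.induct) auto

text \<open>The lexicographically smallest exponent in \<open>S\<close> survives. Its power of the
  head is cancelled by regularity, the terms with a larger head exponent vanish modulo
  \<open>x ^ t\<close>, and the tails form a relation over \<open>ext I (x ^ t)\<close>. At the end
  a single coefficient times \<open>h\<close> lies in the ideal, and invertibility of that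
  coefficient releases \<open>h\<close>.\<close>

lemma regular_relation:
  assumes "is_ideal I" "set xs \<subseteq> C" "regular I xs" "t > 0" "h \<in> C"
    and "finite S" "S \<noteq> {}" "\<And>es. es \<in> S \<Longrightarrow> length es = length xs"
    and "\<And>es. es \<in> S \<Longrightarrow> c es \<in> C \<and> (\<exists>d\<in>C. d * c es = 1)"
    and "(\<Sum>es\<in>S. c es * power_prod t xs es) * h \<in> I"
  shows "h \<in> exts I (map (\<lambda>x. x ^ t) xs)"
  using assms
proof (induction xs arbitrary: I S c)
  case Nil
  then have S: "S = {[]}" by auto
  then obtain d where "d \<in> C" "d * c [] = 1" using Nil.prems by auto
  moreover have "c [] * h \<in> I" using Nil.prems S by simp
  ultimately have "d * (c [] * h) \<in> I" using Nil.prems by (simp add: is_idealD)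
  then show ?case using \<open>d * c [] = 1\<close> by (simp add: mult.assoc[symmetric])
next
  case (Cons x xs)
  have I: "is_ideal I" and x: "x \<in> C" and xs: "set xs \<subseteq> C" using Cons.prems by auto
  let ?y = "x ^ t"
  have y: "?y \<in> C" using x by blast
  define m where "m = Min (hd ` S)"
  have m_le: "m \<le> hd es" if "es \<in> S" for es
    unfolding m_def using that Cons.prems by simp
  have "m \<in> hd ` S" unfolding m_def using Cons.prems by (intro Min_in) auto
  have len: "es = hd es # tl es \<and> length (tl es) = length xs" if "es \<in> S" for es
    using Cons.prems(8)[OF that] by (cases es) auto
  define S' where "S' = {es \<in> S. hd es = m}"
  have S': "finite S'" "S' \<noteq> {}" "S' \<subseteq> S"
    using Cons.prems \<open>m \<in> hd ` S\<close> by (auto simp: S'_def)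
  \<comment> \<open>\<open>q es\<close> is the term that remains after the common factor
    \<open>?y ^ m\<close> is split off; it keeps a factor \<open>?y\<close> unless \<open>es\<close>
    lies in \<open>S'\<close>.\<close>
  define q where "q es = c es * ?y ^ (hd es - m) * power_prod t xs (tl es)" for es
  have q_closed: "q es \<in> C" if "es \<in> S" for es
    unfolding q_def using Cons.prems(9)[OF that] y power_prod_closed[OF xs] by blast
  have term_eq: "c es * power_prod t (x # xs) es = ?y ^ m * q es" if "es \<in> S" for es
  proof -
    have "power_prod t (x # xs) es = ?y ^ hd es * power_prod t xs (tl es)"
      using len[OF that] by (metis power_prod.simps(1))
    also have "?y ^ hd es = ?y ^ m * ?y ^ (hd es - m)"
      using m_le[OF that] by (simp add: power_add[symmetric])
    finally show ?thesis by (simp add: q_def mult_ac)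
  qed
  have sum_closed': "(\<Sum>es\<in>S. q es) * h \<in> C"
    using sum_closed[of S q] q_closed Cons.prems(5) by blast
  have "(\<Sum>es\<in>S. c es * power_prod t (x # xs) es) * h = (x ^ (t * m)) * ((\<Sum>es\<in>S. q es) * h)"
    by (simp add: term_eq sum_distrib_left[symmetric] mult.assoc power_mult)
  then have "(\<Sum>es\<in>S. q es) * h \<in> I"
    using regular_element_power[OF I x _ sum_closed', of "t * m"] Cons.prems(3,10) by simp
  moreover have "(\<Sum>es\<in>S. q es) = (\<Sum>es\<in>S'. q es) + (\<Sum>es\<in>S-S'. q es)"
    using Cons.prems(6) S' by (simp add: sum.subset_diff add.commute)
  moreover have "(\<Sum>es\<in>S-S'. q es) * h = ?y * ((\<Sum>es\<in>S-S'. c es * ?y ^ (hd es - m - 1) * power_prod t xs (tl es)) * h)"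
  proof -
    have "q es = ?y * (c es * ?y ^ (hd es - m - 1) * power_prod t xs (tl es))" if "es \<in> S - S'" for es
    proof -
      have "hd es - m = Suc (hd es - m - 1)" using that m_le[of es] by (auto simp: S'_def)
      then have "?y ^ (hd es - m) = ?y * ?y ^ (hd es - m - 1)" by (metis power_Suc)
      then show ?thesis by (simp add: q_def mult_ac)
    qed
    then show ?thesis by (simp add: sum_distrib_left[symmetric] mult.assoc)
  qed
  moreover have "(\<Sum>es\<in>S-S'. c es * ?y ^ (hd es - m - 1) * power_prod t xs (tl es)) * h \<in> C"
    using Cons.prems(5,9) y power_prod_closed[OF xs] by (intro mult_closed sum_closed) auto
  ultimately have "(\<Sum>es\<in>S'. q es) * h \<in> ext I ?y"
    using extI[of _ I "- ((\<Sum>es\<in>S-S'. c es * ?y ^ (hd es - m - 1) * power_prod t xs (tl es)) * h)" ?y]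
    by (fastforce simp: algebra_simps)
  moreover have "(\<Sum>es\<in>S'. q es) = (\<Sum>es\<in>tl ` S'. c (m # es) * power_prod t xs es)"
  proof -
    have inj: "inj_on tl S'"
      using len by (intro inj_onI) (metis (mono_tags, lifting) S'_def mem_Collect_eq)
    have "q es = c (m # tl es) * power_prod t xs (tl es)" if "es \<in> S'" for es
      using that len[of es] by (auto simp: q_def S'_def)
    then show ?thesis by (simp add: sum.reindex[OF inj])
  qed
  ultimately have rel: "(\<Sum>es\<in>tl ` S'. c (m # es) * power_prod t xs es) * h \<in> ext I ?y" by simp
  have "h \<in> exts (ext I ?y) (map (\<lambda>x. x ^ t) xs)"
  proof (rule Cons.IH[OF _ xs _ _ _ _ _ _ _ rel])
    show "is_ideal (ext I ?y)" using I y by (rule ext_ideal)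
    show "regular (ext I ?y) xs"
      using regular_ext_power[OF I x xs Cons.prems(3), of "t - 1"] Cons.prems(4) by simp
    fix es assume "es \<in> tl ` S'"
    then have "m # es \<in> S" "length es = length xs"
      using len S' by (auto simp: S'_def)
    then show "length es = length xs" "c (m # es) \<in> C \<and> (\<exists>d\<in>C. d * c (m # es) = 1)"
      using Cons.prems(9) by auto
  qed (use Cons.prems S' in auto)
  then show ?case by simp
qed

end

section \<open>Substitution and a chain of prime ideals\<close>

lemma poly_mapping_eq_sum_single: "p = (\<Sum>m\<in>Poly_Mapping.keys p. Poly_Mapping.single m (Poly_Mapping.lookup p m))"
  by (rule poly_mapping_eqI)
    (auto simp: lookup_sum lookup_single when_def sum.delta in_keys_iff)

definition psubst :: "('x \<Rightarrow> (('y \<Rightarrow>\<^sub>0 nat) \<Rightarrow>\<^sub>0 'k)) \<Rightarrow> (('x \<Rightarrow>\<^sub>0 nat) \<Rightarrow>\<^sub>0 'k::comm_ring_1) \<Rightarrow> (('y \<Rightarrow>\<^sub>0 nat) \<Rightarrow>\<^sub>0 'k)" where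
  "psubst g p = (\<Sum>m\<in>Poly_Mapping.keys p. Poly_Mapping.single 0 (Poly_Mapping.lookup p m) *
     (\<Prod>x\<in>Poly_Mapping.keys m. g x ^ Poly_Mapping.lookup m x))"

text \<open>Lets the sum run over any finite set containing the support, so that several polynomials
  can be expanded over one common range.\<close>

lemma psubst_superset:
  assumes "finite S" "Poly_Mapping.keys p \<subseteq> S"
  shows "psubst g p = (\<Sum>m\<in>S. Poly_Mapping.single 0 (Poly_Mapping.lookup p m) *
     (\<Prod>x\<in>Poly_Mapping.keys m. g x ^ Poly_Mapping.lookup m x))"
  unfolding psubst_def
  by (rule sum.mono_neutral_left) (use assms in \<open>auto simp: in_keys_iff\<close>)

lemma psubst_zero [simp]: "psubst g 0 = 0"
  by (simp add: psubst_def)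

lemma psubst_add: "psubst g (p + q) = psubst g p + psubst g q"
  using keys_add[of p q]
  by (subst (1 2 3) psubst_superset[of "Poly_Mapping.keys p \<union> Poly_Mapping.keys q"])
    (auto simp: lookup_add single_add distrib_right sum.distrib)

lemma psubst_sum: "psubst g (sum f S) = (\<Sum>i\<in>S. psubst g (f i))"
  by (induction S rule: infinite_finite_induct) (auto simp: psubst_add)

lemma psubst_uminus: "psubst g (- p) = - psubst g p"
  using psubst_add[of g p "- p"] by (simp add: minus_unique)

lemma psubst_diff: "psubst g (p - q) = psubst g p - psubst g q"
  using psubst_add[of g p "- q"] by (simp add: psubst_uminus)

lemma psubst_single:
  "psubst g (Poly_Mapping.single m c) =
     Poly_Mapping.single 0 c * (\<Prod>x\<in>Poly_Mapping.keys m. g x ^ Poly_Mapping.lookup m x)"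
  by (subst psubst_superset[of "{m}"]) auto

lemma prod_power_add:
  fixes m m' :: "'x \<Rightarrow>\<^sub>0 nat" and g :: "'x \<Rightarrow> 'r::comm_monoid_mult"
  shows "(\<Prod>x\<in>Poly_Mapping.keys (m + m'). g x ^ Poly_Mapping.lookup (m + m') x) =
    (\<Prod>x\<in>Poly_Mapping.keys m. g x ^ Poly_Mapping.lookup m x) * (\<Prod>x\<in>Poly_Mapping.keys m'. g x ^ Poly_Mapping.lookup m' x)"
proof -
  let ?S = "Poly_Mapping.keys m \<union> Poly_Mapping.keys m'"
  have *: "(\<Prod>x\<in>Poly_Mapping.keys n. g x ^ Poly_Mapping.lookup n x) = (\<Prod>x\<in>?S. g x ^ Poly_Mapping.lookup n x)"
    if "Poly_Mapping.keys n \<subseteq> ?S" for n :: "'x \<Rightarrow>\<^sub>0 nat"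
    by (rule prod.mono_neutral_left) (use that in \<open>auto simp: in_keys_iff\<close>)
  show ?thesis
    using keys_add[of m m'] by (subst (1 2 3) *) (auto simp: lookup_add power_add prod.distrib)
qed

lemma single_mult: "Poly_Mapping.single 0 (a * b) = Poly_Mapping.single 0 a * Poly_Mapping.single 0 b"
  for a b :: "'k::comm_ring_1"
  by (simp add: mult_single)

lemma psubst_mult: "psubst g (p * q) = psubst g p * psubst g q"
proof -
  have "p * q = (\<Sum>m\<in>Poly_Mapping.keys p. \<Sum>n\<in>Poly_Mapping.keys q.
      Poly_Mapping.single m (Poly_Mapping.lookup p m) * Poly_Mapping.single n (Poly_Mapping.lookup q n))"
    by (subst poly_mapping_eq_sum_single[of p], subst poly_mapping_eq_sum_single[of q]) (simp add: sum_product)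
  also have "psubst g \<dots> = (\<Sum>m\<in>Poly_Mapping.keys p. \<Sum>n\<in>Poly_Mapping.keys q.
      psubst g (Poly_Mapping.single m (Poly_Mapping.lookup p m)) * psubst g (Poly_Mapping.single n (Poly_Mapping.lookup q n)))"
    unfolding psubst_sum
    by (intro sum.cong refl) (simp only: mult_single psubst_single prod_power_add, simp add: single_mult mult_ac)
  also have "\<dots> = psubst g p * psubst g q"
    by (simp only: sum_product[symmetric] psubst_sum[symmetric] poly_mapping_eq_sum_single[symmetric])
  finally show ?thesis .
qed

lemma psubst_one [simp]: "psubst g 1 = 1"
  using psubst_single[of g 0 1] by simp

lemma psubst_power: "psubst g (p ^ j) = psubst g p ^ j"
  by (induction j) (auto simp: psubst_mult)

lemma psubst_prod: "psubst g (prod f S) = (\<Prod>i\<in>S. psubst g (f i))"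
  by (induction S rule: infinite_finite_induct) (auto simp: psubst_mult)

lemma psubst_pvar [simp]: "psubst g (pvar x) = g x"
  by (simp add: pvar_def psubst_single)

lemma psubst_psubst: "psubst g' (psubst g p) = psubst (\<lambda>x. psubst g' (g x)) p"
  unfolding psubst_def[of g] psubst_def[of "\<lambda>x. psubst g' (g x)"]
  by (simp add: psubst_sum psubst_mult psubst_prod psubst_power psubst_single)

lemma pvar_nonzero [simp]: "pvar x \<noteq> (0 :: ('x \<Rightarrow>\<^sub>0 nat) \<Rightarrow>\<^sub>0 'k::comm_ring_1)"
  by (metis pvar_def lookup_single_eq lookup_zero zero_neq_one)

lemma pvar_inj: "(pvar x :: ('x \<Rightarrow>\<^sub>0 nat) \<Rightarrow>\<^sub>0 'k::comm_ring_1) = pvar y \<Longrightarrow> x = y"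
  unfolding pvar_def
  by (metis lookup_single_not_eq lookup_single_eq zero_neq_one)

section \<open>Polynomial rings on a vertex set and their prime ideals\<close>

lemma subring_poly_ring: "subring_set (carrier (poly_ring V) :: ('v,'k::field) mpoly set)"
proof
  fix a b :: "('v,'k) mpoly"
  assume a: "a \<in> carrier (poly_ring V)" and b: "b \<in> carrier (poly_ring V)"
  show "a + b \<in> carrier (poly_ring V)"
    using a b keys_add[of a b] unfolding poly_ring_def by auto
  show "a * b \<in> carrier (poly_ring V)"
    unfolding poly_ring_def partial_object.select_convs mem_Collect_eq
  proof (intro ballI)
    fix m x assume "m \<in> Poly_Mapping.keys (a * b)" and x: "x \<in> Poly_Mapping.keys m"
    then obtain m1 m2 where "m1 \<in> Poly_Mapping.keys a" "m2 \<in> Poly_Mapping.keys b" "m = m1 + m2"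
      using keys_mult[of a b] by blast
    with a b x show "fst x \<in> V"
      using keys_add[of m1 m2] unfolding poly_ring_def by auto
  qed
qed (auto simp: poly_ring_def)

lemma poly_ring_eq_as_ring: "poly_ring V = subring_set.as_ring (carrier (poly_ring V))"
  unfolding subring_set.as_ring_def[OF subring_poly_ring] by (simp add: poly_ring_def)

lemma pvar_in_poly_ring: "fst x \<in> V \<Longrightarrow> pvar x \<in> carrier (poly_ring V)"
  by (auto simp: pvar_def poly_ring_def)

lemma vars_in_poly_ring:
  assumes "v \<in> V"
  shows "var_a v \<in> carrier (poly_ring V)" "var_b v \<in> carrier (poly_ring V)"
  using assms by (auto simp: var_a_def var_b_def pvar_in_poly_ring)

lemma minor_in_poly_ring:
  assumes "u \<in> V" "v \<in> V"
  shows "(var_a u * var_b v - var_a v * var_b u :: ('v,'k::field) mpoly) \<in> carrier (poly_ring V)"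
proof -
  interpret subring_set "carrier (poly_ring V) :: ('v,'k) mpoly set" by (rule subring_poly_ring)
  show ?thesis using assms by (intro diff_closed mult_closed vars_in_poly_ring)
qed

text \<open>The target variables are indexed by \<open>nat\<close>, so its monomials are linearly
  ordered and the target ring has no zero divisors; the kernel of a homomorphism into it is
  prime.\<close>

lemma primeideal_ker_psubst:
  fixes g :: "'v \<times> bool \<Rightarrow> (nat \<Rightarrow>\<^sub>0 nat) \<Rightarrow>\<^sub>0 'k::field"
  shows "primeideal {p \<in> carrier (poly_ring V). psubst g p = 0} (poly_ring V)"
proof -
  interpret S: subring_set "carrier (poly_ring V) :: ('v,'k) mpoly set" by (rule subring_poly_ring)
  let ?I = "{p \<in> carrier (poly_ring V). psubst g p = 0}"
  have "S.is_ideal ?I"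
    unfolding S.is_ideal_def by (auto simp: psubst_add psubst_mult)
  then have ideal: "ideal ?I S.as_ring" by (simp add: S.ideal_iff_is_ideal)
  have "primeideal ?I S.as_ring"
  proof (rule primeidealI[OF ideal S.cring_as_ring])
    have "1 \<in> carrier S.as_ring" "1 \<notin> ?I" by simp_all
    then show "carrier S.as_ring \<noteq> ?I" by metis
  qed (auto simp: psubst_mult)
  then show ?thesis by (simp add: poly_ring_eq_as_ring[symmetric])
qed

lemma ex_index:
  assumes "finite W"
  obtains idx where "bij_betw idx W {..<card W}"
  using ex_bij_betw_finite_nat[OF assms] by (auto simp: atLeast0LessThan)

text \<open>The chain starts with the kernel of the parametrisation \<open>a\<^sub>v = y\<^sub>v\<close>, \<open>b\<^sub>v = t y\<^sub>v\<close> of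
  the rank one matrices supported on \<open>W\<close> and kills one parameter after the other: first all but
  one of the \<open>y\<^sub>v\<close>, then \<open>t\<close>, then the last \<open>y\<^sub>v\<close>.\<close>

lemma krull_dim_binomial_edge_ideal_ge:
  fixes E :: "'v \<Rightarrow> 'v \<Rightarrow> bool"
  assumes W: "finite W" "W \<subseteq> V" "W \<noteq> {}"
  shows "enat (card W + 1) \<le> krull_dim_quot (poly_ring V) (binomial_edge_ideal V E :: ('v,'k::field) mpoly set)"
proof -
  define N where "N = card W"
  have N: "N > 0" using W by (simp add: N_def card_gt_0_iff)
  obtain idx where bij: "bij_betw idx W {..<N}" using ex_index[OF W(1)] unfolding N_def .
  \<comment> \<open>Vertices outside \<open>W\<close> go to zero. The \<open>min\<close> keeps the
    parameter of index \<open>N - 1\<close> alive through stage \<open>N\<close>: all variables are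
    sent to multiples of the y's, so the loss of t is visible only while some y is left.\<close>
  define \<alpha> :: "nat \<Rightarrow> 'v \<Rightarrow> (nat \<Rightarrow>\<^sub>0 nat) \<Rightarrow>\<^sub>0 'k" where
    "\<alpha> i v = (if v \<in> W \<and> min i (N - 1) \<le> idx v \<and> i \<le> N then pvar (idx v) else 0)" for i v
  define \<tau> :: "nat \<Rightarrow> (nat \<Rightarrow>\<^sub>0 nat) \<Rightarrow>\<^sub>0 'k" where "\<tau> i = (if i < N then pvar N else 0)" for i
  define \<phi> where "\<phi> i = (\<lambda>(v, s). if s then \<alpha> i v else \<tau> i * \<alpha> i v)" for i
  \<comment> \<open>\<open>\<psi> i\<close> kills the parameter lost between stages \<open>i\<close>
    and \<open>Suc i\<close>; index \<open>N\<close> stands for t. Composition with it shows that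
    the kernels increase.\<close>
  define \<psi> :: "nat \<Rightarrow> nat \<Rightarrow> (nat \<Rightarrow>\<^sub>0 nat) \<Rightarrow>\<^sub>0 'k" where
    "\<psi> i j = (if i < N - 1 \<and> j = i \<or> i = N - 1 \<and> j = N \<or> i = N then 0 else pvar j)" for i j
  define P where "P i = {p \<in> carrier (poly_ring V). psubst (\<phi> i) p = 0}" for i
  have idx_less: "idx v < N" if "v \<in> W" for v using bij that by (auto simp: bij_betw_def)
  have \<phi>_a: "psubst (\<phi> i) (var_a v) = \<alpha> i v" and \<phi>_b: "psubst (\<phi> i) (var_b v) = \<tau> i * \<alpha> i v" for i v
    by (simp_all add: var_a_def var_b_def \<phi>_def)
  have \<alpha>_step: "psubst (\<psi> i) (\<alpha> i v) = \<alpha> (Suc i) v" if "i \<le> N" for i v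
    using that N idx_less[of v] unfolding \<alpha>_def \<psi>_def by auto
  have \<tau>_step: "psubst (\<psi> i) (\<tau> i) * \<alpha> (Suc i) v = \<tau> (Suc i) * \<alpha> (Suc i) v" if "i \<le> N" for i v
    using that N unfolding \<tau>_def \<psi>_def by (auto simp: \<alpha>_def)
  have \<phi>_step: "psubst (\<psi> i) (\<phi> i x) = \<phi> (Suc i) x" if "i \<le> N" for i x
    using that by (cases x) (simp add: \<phi>_def psubst_mult \<alpha>_step \<tau>_step)
  have J: "binomial_edge_ideal V E \<subseteq> P i" for i
  proof -
    have prime: "primeideal (P i) (poly_ring V)" unfolding P_def by (rule primeideal_ker_psubst)
    have gens: "{var_a u * var_b v - var_a v * var_b u | u v. u \<in> V \<and> v \<in> V \<and> E u v} \<subseteq> P i"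
      by (auto simp: P_def psubst_diff psubst_mult \<phi>_a \<phi>_b minor_in_poly_ring)
    have "ideal (P i) (poly_ring V)" using prime by (simp add: primeideal_def)
    then show ?thesis
      using gens unfolding binomial_edge_ideal_def genideal_def by blast
  qed
  have strict: "P i \<subset> P (Suc i)" if i: "i \<le> N" for i
  proof -
    have sub: "P i \<subseteq> P (Suc i)"
    proof
      fix p assume "p \<in> P i"
      moreover have "psubst (\<phi> (Suc i)) p = psubst (\<psi> i) (psubst (\<phi> i) p)"
        by (simp only: psubst_psubst \<phi>_step[OF i])
      ultimately show "p \<in> P (Suc i)" by (simp add: P_def)
    qed
    \<comment> \<open>The vertex with the smallest surviving index witnesses strictness: through
      \<open>var_b\<close> at stage \<open>N - 1\<close>, where t is lost, and through
      \<open>var_a\<close> at all other stages.\<close>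
    have "min i (N - 1) \<in> idx ` W" using bij N by (auto simp: bij_betw_def)
    then obtain w where w: "w \<in> W" "idx w = min i (N - 1)" by auto
    then have wV: "w \<in> V" using W by auto
    have \<alpha>_nz: "\<alpha> i w \<noteq> 0" using w i by (simp add: \<alpha>_def)
    have "\<exists>p \<in> P (Suc i). p \<notin> P i"
    proof (cases "i = N - 1")
      case True
      then have "var_b w \<in> P (Suc i)" "var_b w \<notin> P i"
        using \<alpha>_nz N wV by (auto simp: P_def \<phi>_b \<tau>_def vars_in_poly_ring)
      then show ?thesis by blast
    next
      case False
      have "\<alpha> (Suc i) w = 0" using False w i N by (auto simp: \<alpha>_def)
      then have "var_a w \<in> P (Suc i)" "var_a w \<notin> P i"
        using \<alpha>_nz wV by (auto simp: P_def \<phi>_a vars_in_poly_ring)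
      then show ?thesis by blast
    qed
    with sub show ?thesis by blast
  qed
  have "\<exists>P :: nat \<Rightarrow> ('v,'k) mpoly set. (\<forall>i\<le>N + 1. primeideal (P i) (poly_ring V) \<and> binomial_edge_ideal V E \<subseteq> P i) \<and>
      (\<forall>i<N + 1. P i \<subset> P (Suc i))"
  proof (intro exI[of _ P] conjI allI impI)
    show "primeideal (P i) (poly_ring V)" for i unfolding P_def by (rule primeideal_ker_psubst)
  qed (use J strict in auto)
  then show ?thesis
    unfolding krull_dim_quot_def N_def by (intro Sup_upper) blast
qed

section \<open>A bound on the depth\<close>

text \<open>A homogeneous linear system with more unknowns than equations, solved by elimination: a
  pivot \<open>a0\<close> removes one equation together with one unknown.\<close>

lemma ex_nontrivial_relation:
  fixes M :: "'a \<Rightarrow> 'b \<Rightarrow> 'k::field"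
  assumes "finite B" "finite A" "card B < card A"
  shows "\<exists>c. (\<exists>a\<in>A. c a \<noteq> 0) \<and> (\<forall>b\<in>B. (\<Sum>a\<in>A. c a * M a b) = 0)"
  using assms
proof (induction B arbitrary: A M rule: finite_induct)
  case empty
  then have "A \<noteq> {}" by auto
  then show ?case by (intro exI[of _ "\<lambda>_. 1"]) auto
next
  case (insert b B)
  show ?case
  proof (cases "\<forall>a\<in>A. M a b = 0")
    case True
    have "card B < card A" using insert by simp
    then obtain c where "\<exists>a\<in>A. c a \<noteq> 0" "\<forall>b\<in>B. (\<Sum>a\<in>A. c a * M a b) = 0"
      using insert.IH insert.prems by blast
    then show ?thesis using True by (intro exI[of _ c]) auto
  next
    case False
    then obtain a0 where a0: "a0 \<in> A" "M a0 b \<noteq> 0" by blast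
    define A' where "A' = A - {a0}"
    have A: "A = insert a0 A'" "a0 \<notin> A'" "finite A'" using a0 insert by (auto simp: A'_def)
    have "card B < card A'" using insert A by simp
    then obtain c where c: "\<exists>a\<in>A'. c a \<noteq> 0"
      "\<forall>b'\<in>B. (\<Sum>a\<in>A'. c a * (M a b' - M a b / M a0 b * M a0 b')) = 0"
      using insert.IH[OF A(3), of "\<lambda>a b'. M a b' - M a b / M a0 b * M a0 b'"] by blast
    \<comment> \<open>The pivot coefficient is the one that solves the equation of
      \<open>b\<close>.\<close>
    define c0 where "c0 = - (\<Sum>a\<in>A'. c a * M a b) / M a0 b"
    define c' where "c' a = (if a = a0 then c0 else c a)" for a
    have sum_eq: "(\<Sum>a\<in>A. c' a * M a b') = c0 * M a0 b' + (\<Sum>a\<in>A'. c a * M a b')" for b'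
    proof -
      have "(\<Sum>a\<in>A'. c' a * M a b') = (\<Sum>a\<in>A'. c a * M a b')"
        using A by (intro sum.cong) (auto simp: c'_def)
      then show ?thesis using A by (simp add: c'_def)
    qed
    have c0: "c0 * x = - (\<Sum>a\<in>A'. c a * (M a b / M a0 b * x))" for x
      by (simp add: c0_def sum_divide_distrib sum_distrib_right mult.assoc)
    have "(\<Sum>a\<in>A. c' a * M a b') = 0" if "b' \<in> insert b B" for b'
    proof (cases "b' = b")
      case True
      then show ?thesis using a0 by (simp add: sum_eq c0_def)
    next
      case False
      then have "(\<Sum>a\<in>A'. c a * (M a b' - M a b / M a0 b * M a0 b')) = 0" using c that by blast
      then show ?thesis
        unfolding sum_eq c0 by (simp add: sum_subtractf right_diff_distrib)
    qed
    moreover have "\<exists>a\<in>A. c' a \<noteq> 0" using c(1) A by (auto simp: c'_def)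
    ultimately show ?thesis by blast
  qed
qed

section \<open>Total degree, monomial counts and monomial ideals\<close>

definition mdeg :: "('x \<Rightarrow>\<^sub>0 nat) \<Rightarrow> nat" where
  "mdeg m = (\<Sum>x\<in>Poly_Mapping.keys m. Poly_Mapping.lookup m x)"

lemma mdeg_add: "mdeg (m + n) = mdeg m + mdeg n"
proof -
  let ?S = "Poly_Mapping.keys m \<union> Poly_Mapping.keys n"
  have *: "mdeg k = (\<Sum>x\<in>?S. Poly_Mapping.lookup k x)" if "Poly_Mapping.keys k \<subseteq> ?S" for k
    unfolding mdeg_def by (rule sum.mono_neutral_left) (use that in \<open>auto simp: in_keys_iff\<close>)
  show ?thesis
    using keys_add[of m n] by (subst (1 2 3) *) (auto simp: lookup_add sum.distrib)
qed

lemma lookup_le_mdeg: "Poly_Mapping.lookup m x \<le> mdeg m"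
  by (cases "x \<in> Poly_Mapping.keys m") (auto simp: mdeg_def in_keys_iff intro: member_le_sum)

lemma keys_multE:
  assumes "m \<in> Poly_Mapping.keys (p * q)"
  obtains m1 m2 where "m1 \<in> Poly_Mapping.keys p" "m2 \<in> Poly_Mapping.keys q" "m = m1 + m2"
  using assms keys_mult[of p q] by blast

text \<open>Bounds on monomials rather than an order and a degree function: zero satisfies
  \<open>low d\<close> and \<open>high d\<close> for every \<open>d\<close>, so products need no
  case distinction.\<close>

definition low :: "nat \<Rightarrow> (('x \<Rightarrow>\<^sub>0 nat) \<Rightarrow>\<^sub>0 'k::comm_ring_1) \<Rightarrow> bool" where
  "low d p \<longleftrightarrow> (\<forall>m\<in>Poly_Mapping.keys p. d \<le> mdeg m)"

definition high :: "nat \<Rightarrow> (('x \<Rightarrow>\<^sub>0 nat) \<Rightarrow>\<^sub>0 'k::comm_ring_1) \<Rightarrow> bool" where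
  "high d p \<longleftrightarrow> (\<forall>m\<in>Poly_Mapping.keys p. mdeg m \<le> d)"

lemma low_mult: "low d p \<Longrightarrow> low e q \<Longrightarrow> low (d + e) (p * q)"
  unfolding low_def by (auto elim!: keys_multE simp: mdeg_add intro!: add_mono)

lemma high_mult: "high d p \<Longrightarrow> high e q \<Longrightarrow> high (d + e) (p * q)"
  unfolding high_def by (auto elim!: keys_multE simp: mdeg_add intro!: add_mono)

lemma low_power: "low 1 p \<Longrightarrow> low j (p ^ j)"
proof (induction j)
  case (Suc j)
  then show ?case using low_mult[of 1 p j "p ^ j"] by simp
qed (simp add: low_def)

lemma high_one: "high d 1"
  by (simp add: high_def mdeg_def)

lemma high_power: "high d p \<Longrightarrow> high (j * d) (p ^ j)"
proof (induction j)
  case (Suc j)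
  then show ?case using high_mult[of d p "j * d" "p ^ j"] by simp
qed (simp add: high_one)

lemma high_mono: "high d p \<Longrightarrow> d \<le> e \<Longrightarrow> high e p"
  unfolding high_def by auto

lemma ex_high: "\<exists>d. high d p"
  unfolding high_def using finite_nat_set_iff_bounded_le[of "mdeg ` Poly_Mapping.keys p"] by auto

lemma high_power_prod:
  "(\<And>x. x \<in> set xs \<Longrightarrow> high e x) \<Longrightarrow> (\<And>j. j \<in> set es \<Longrightarrow> j \<le> D) \<Longrightarrow>
    high (length xs * (D * (t * e))) (power_prod t xs es)"
proof (induction t xs es rule: power_prod.induct)
  case (1 t x xs j es)
  have "high (j * (t * e)) ((x ^ t) ^ j)" using 1 by (intro high_power) auto
  moreover have "j * (t * e) \<le> D * (t * e)" using 1 by (intro mult_right_mono) auto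
  ultimately have "high (D * (t * e)) ((x ^ t) ^ j)" by (rule high_mono)
  moreover have "high (length xs * (D * (t * e))) (power_prod t xs es)" using 1 by auto
  ultimately show ?case using high_mult by fastforce
qed (auto simp: high_one)

lemma lookup_const_mult:
  "Poly_Mapping.lookup (Poly_Mapping.single 0 c * p) m = c * Poly_Mapping.lookup p m"
  for p :: "('x::monoid_add) \<Rightarrow>\<^sub>0 'k::comm_ring_1"
  by (simp add: mult_map_scale_conv_mult[symmetric] map.rep_eq when_def)

text \<open>A monomial in \<open>X\<close> is determined by its exponents on \<open>X\<close>, each
  at most its degree. The bound is crude, but the exponent \<open>card X\<close> is what the
  counting relies on.\<close>

lemma card_bounded_monomials:
  assumes "finite X"
  shows "finite {m. Poly_Mapping.keys m \<subseteq> X \<and> mdeg m \<le> E}" (is "finite ?M")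
    and "card {m. Poly_Mapping.keys m \<subseteq> X \<and> mdeg m \<le> E} \<le> (E + 1) ^ card X"
proof -
  let ?F = "\<lambda>m. restrict (Poly_Mapping.lookup m) X"
  have inj: "inj_on ?F ?M"
  proof (intro inj_onI poly_mapping_eqI)
    fix m n x assume mn: "m \<in> ?M" "n \<in> ?M" "?F m = ?F n"
    show "Poly_Mapping.lookup m x = Poly_Mapping.lookup n x"
    proof (cases "x \<in> X")
      case True
      then show ?thesis using fun_cong[OF mn(3), of x] by simp
    next
      case False
      then have "x \<notin> Poly_Mapping.keys m" "x \<notin> Poly_Mapping.keys n" using mn by auto
      then show ?thesis by (simp add: in_keys_iff)
    qed
  qed
  have im: "?F ` ?M \<subseteq> X \<rightarrow>\<^sub>E {..E}"
    using order_trans[OF lookup_le_mdeg] by auto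
  have fin: "finite (X \<rightarrow>\<^sub>E {..E})" using assms by (simp add: finite_PiE)
  show "finite ?M" using finite_imageD[OF finite_subset[OF im fin] inj] .
  show "card ?M \<le> (E + 1) ^ card X"
    using card_inj_on_le[OF inj im fin] assms by (simp add: card_funcsetE)
qed

text \<open>Used for three upward closed sets of monomials: those of positive degree, those
  involving a variable outside \<open>U\<close>, and the union of the latter with those of degree at
  least \<open>t\<close>.\<close>

lemma monomial_ideal:
  assumes up: "\<And>m n. P n \<Longrightarrow> P (m + n)"
  shows "subring_set.is_ideal (carrier (poly_ring V))
    {p \<in> carrier (poly_ring V) :: ('v,'k::field) mpoly set. \<forall>m\<in>Poly_Mapping.keys p. P m}" (is "subring_set.is_ideal _ ?I")
proof -
  interpret S: subring_set "carrier (poly_ring V) :: ('v,'k) mpoly set" by (rule subring_poly_ring)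
  show ?thesis
    unfolding S.is_ideal_def
  proof (intro conjI ballI)
    fix a b assume "a \<in> ?I" "b \<in> ?I"
    then show "a + b \<in> ?I" using keys_add[of a b] by auto
  next
    fix c a :: "('v,'k) mpoly" assume "c \<in> carrier (poly_ring V)" "a \<in> ?I"
    then show "c * a \<in> ?I" using up by (auto elim: keys_multE)
  qed auto
qed

lemma irrelevant_ideal_low:
  fixes p :: "('v,'k::field) mpoly"
  assumes "p \<in> irrelevant_ideal V"
  shows "p \<in> carrier (poly_ring V)" "low 1 p"
proof -
  interpret S: subring_set "carrier (poly_ring V) :: ('v,'k) mpoly set" by (rule subring_poly_ring)
  let ?I = "{p \<in> carrier (poly_ring V) :: ('v,'k) mpoly set. \<forall>m\<in>Poly_Mapping.keys p. 1 \<le> mdeg m}"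
  have "irrelevant_ideal V = S.gen ({var_a v |v. v \<in> V} \<union> {var_b v |v. v \<in> V})"
    unfolding irrelevant_ideal_def S.gen_def poly_ring_eq_as_ring[symmetric] ..
  also have "\<dots> \<subseteq> ?I"
  proof (rule S.gen_minimal)
    show "S.is_ideal ?I" by (rule monomial_ideal) (simp add: mdeg_add)
    show "{var_a v |v. v \<in> V} \<union> {var_b v |v. v \<in> V} \<subseteq> ?I"
      by (auto simp: var_a_def var_b_def pvar_in_poly_ring) (auto simp: pvar_def mdeg_def)
  qed
  finally show "p \<in> carrier (poly_ring V)" "low 1 p" using assms by (auto simp: low_def)
qed

text \<open>Each monomial of \<open>p\<close> contains a variable that already sends
  \<open>h\<close> into \<open>J\<close>; the rest of the monomial is only a multiplier.\<close>

lemma mult_in_ideal_if_involves: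
  fixes h :: "('v,'k::field) mpoly"
  assumes J: "subring_set.is_ideal (carrier (poly_ring V)) J"
    and h: "\<And>v s. v \<in> V - U \<Longrightarrow> pvar (v, s) * h \<in> J"
    and p: "p \<in> carrier (poly_ring V)" "\<And>m. m \<in> Poly_Mapping.keys p \<Longrightarrow> \<exists>x\<in>Poly_Mapping.keys m. fst x \<notin> U"
  shows "p * h \<in> J"
proof -
  interpret S: subring_set "carrier (poly_ring V) :: ('v,'k) mpoly set" by (rule subring_poly_ring)
  have "Poly_Mapping.single m c * h \<in> J" if m: "m \<in> Poly_Mapping.keys p" for m and c :: 'k
  proof -
    obtain x where x: "x \<in> Poly_Mapping.keys m" "fst x \<notin> U" using p(2)[OF m] by blast
    have keys_m: "\<forall>x\<in>Poly_Mapping.keys m. fst x \<in> V" using p(1) m by (auto simp: poly_ring_def)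
    define m' where "m' = m - Poly_Mapping.single x 1"
    have m_eq: "m = m' + Poly_Mapping.single x 1"
    proof (rule poly_mapping_eqI)
      fix y show "Poly_Mapping.lookup m y = Poly_Mapping.lookup (m' + Poly_Mapping.single x 1) y"
        using x by (auto simp: m'_def lookup_add lookup_minus lookup_single when_def in_keys_iff)
    qed
    have "Poly_Mapping.keys m' \<subseteq> Poly_Mapping.keys m"
      unfolding m_eq by (auto simp: in_keys_iff lookup_add)
    then have C: "Poly_Mapping.single m' c \<in> carrier (poly_ring V)"
      using keys_m by (auto simp: poly_ring_def)
    have "Poly_Mapping.single m c * h = Poly_Mapping.single m' c * (pvar x * h)"
      by (simp add: m_eq pvar_def mult_single mult.assoc[symmetric])
    also have "\<dots> \<in> J"
      using h[of "fst x" "snd x"] x keys_m by (intro S.is_idealD(4)[OF J C]) auto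
    finally show ?thesis .
  qed
  then have "(\<Sum>m\<in>Poly_Mapping.keys p. Poly_Mapping.single m (Poly_Mapping.lookup p m) * h) \<in> J"
    by (intro S.is_ideal_sum[OF J])
  then show ?thesis
    by (simp add: sum_distrib_right[symmetric] poly_mapping_eq_sum_single[symmetric])
qed

text \<open>The hypotheses on \<open>h\<close> make the prime generated by the variables outside \<open>U\<close> an associated
  prime of \<open>J\<close>. More than \<open>2 card U\<close> elements have an algebraic relation modulo this prime, which
  therefore annihilates \<open>h\<close> modulo \<open>J\<close>; for a regular sequence \<open>f\<close> this forces \<open>h\<close> into
  \<open>J + (f\<^sub>1\<^sup>t, \<dots>, f\<^sub>r\<^sup>t)\<close>, for every \<open>t\<close>.\<close>

lemma depth_quot_le:
  fixes h :: "('v,'k::field) mpoly" and g :: "'v \<times> bool \<Rightarrow> (nat \<Rightarrow>\<^sub>0 nat) \<Rightarrow>\<^sub>0 'k"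
  assumes U: "finite U"
    and J: "subring_set.is_ideal (carrier (poly_ring V)) J"
    and J_involves: "\<And>p m. p \<in> J \<Longrightarrow> m \<in> Poly_Mapping.keys p \<Longrightarrow> \<exists>x\<in>Poly_Mapping.keys m. fst x \<notin> U"
    and h: "h \<in> carrier (poly_ring V)" "\<And>v s. v \<in> V - U \<Longrightarrow> pvar (v, s) * h \<in> J"
    and g: "\<And>x. fst x \<notin> U \<Longrightarrow> g x = 0" "psubst g h \<noteq> 0"
  shows "depth_quot (poly_ring V) (irrelevant_ideal V) J \<le> enat (2 * card U)"
  unfolding depth_quot_def
proof (rule Sup_least, clarify)
  fix r and f :: "nat \<Rightarrow> ('v,'k) mpoly"
  interpret S: subring_set "carrier (poly_ring V) :: ('v,'k) mpoly set" by (rule subring_poly_ring)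
  assume f_irr: "\<forall>i<r. f i \<in> irrelevant_ideal V"
    and f_reg: "\<forall>i<r. \<forall>g\<in>carrier (poly_ring V).
          f i \<otimes>\<^bsub>poly_ring V\<^esub> g \<in> genideal (poly_ring V) (J \<union> f ` {..<i}) \<longrightarrow>
          g \<in> genideal (poly_ring V) (J \<union> f ` {..<i})"
  have f: "f i \<in> carrier (poly_ring V)" "low 1 (f i)" if "i < r" for i
    using irrelevant_ideal_low[of "f i" V] f_irr that by auto
  define fs where "fs = map f [0..<r]"
  have fs: "set fs \<subseteq> carrier (poly_ring V)" "length fs = r" using f by (auto simp: fs_def)
  have reg: "S.regular J fs"
    unfolding fs_def
  proof (rule S.regular_if_depth_seq[OF J])
    fix i g assume "i < r" "g \<in> carrier (poly_ring V)" "f i * g \<in> S.gen (J \<union> f ` {..<i})"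
    then show "g \<in> S.gen (J \<union> f ` {..<i})"
      using f_reg unfolding S.gen_def poly_ring_eq_as_ring[symmetric] by (simp add: poly_ring_def)
  qed (use f in auto)
  obtain d0 where d0: "high d0 h" using ex_high by blast
  \<comment> \<open>Larger than the degree of \<open>h\<close>, so that \<open>f i ^ t\<close>,
    whose monomials have degree at least \<open>t\<close>, cannot account for a monomial of
    \<open>h\<close>.\<close>
  define t where "t = Suc d0"
  define e where "e = (\<Sum>i<r. SOME d. high d (f i))"
  have e: "high e x" if x: "x \<in> set fs" for x
  proof -
    obtain i where i: "i < r" "x = f i" using x by (auto simp: fs_def)
    have "high (SOME d. high d (f i)) (f i)" using someI_ex[OF ex_high] .
    moreover have "(SOME d. high d (f i)) \<le> e"
      unfolding e_def using i by (intro member_le_sum) auto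
    ultimately show ?thesis using i high_mono by blast
  qed
  define d where "d = 2 * card U"
  define X where "X = U \<times> (UNIV :: bool set)"
  have X: "finite X" "card X = d" using U by (simp_all add: X_def d_def card_cartesian_product)
  show "enat r \<le> enat (2 * card U)"
  proof (rule ccontr)
    assume "\<not> enat r \<le> enat (2 * card U)"
    then have r: "d < r" by (simp add: d_def)
    \<comment> \<open>There are \<open>D ^ r\<close> products with exponents below \<open>D\<close>,
      of degree at most \<open>E\<close>, against at most \<open>(E + 1) ^ d\<close> monomials in
      \<open>X\<close>. As \<open>E + 1\<close> is at most \<open>(r * (t * e) + 1) * D\<close>, the
      choice of \<open>D\<close> and \<open>d < r\<close> make the products outnumber the
      monomials.\<close>
    define D where "D = (r * (t * e) + 1) ^ d + 1"
    define E where "E = r * (D * (t * e))"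
    define L where "L = {es :: nat list. set es \<subseteq> {..<D} \<and> length es = r}"
    define M where "M = {m. Poly_Mapping.keys m \<subseteq> X \<and> mdeg m \<le> E}"
    have L: "finite L" "card L = D ^ r"
      unfolding L_def by (simp_all add: finite_lists_length_eq card_lists_length_eq)
    have "card M \<le> (E + 1) ^ d"
      unfolding M_def X(2)[symmetric] by (rule card_bounded_monomials[OF X(1)])
    also have "E + 1 \<le> (r * (t * e) + 1) * D"
      unfolding E_def by (simp add: algebra_simps D_def)
    then have "(E + 1) ^ d \<le> ((r * (t * e) + 1) * D) ^ d" by (rule power_mono) simp
    also have "\<dots> = (r * (t * e) + 1) ^ d * D ^ d" by (simp only: power_mult_distrib)
    also have "\<dots> < D * D ^ d" by (simp add: D_def)
    also have "\<dots> \<le> D ^ r"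
      using power_increasing[of "Suc d" r D] r by (simp add: D_def)
    finally have "card M < card L" using L by simp
    moreover have "finite M" unfolding M_def by (rule card_bounded_monomials[OF X(1)])
    \<comment> \<open>The unknowns are the coefficients of the products; there is one equation for
      each monomial of \<open>M\<close>, asking that it cancel.\<close>
    ultimately have "\<exists>c. (\<exists>es\<in>L. c es \<noteq> 0) \<and>
        (\<forall>m\<in>M. (\<Sum>es\<in>L. c es * Poly_Mapping.lookup (power_prod t fs es) m) = 0)"
      using L(1) by (intro ex_nontrivial_relation)
    then obtain c where c: "\<exists>es\<in>L. c es \<noteq> 0"
      "\<forall>m\<in>M. (\<Sum>es\<in>L. c es * Poly_Mapping.lookup (power_prod t fs es) m) = 0"
      by (elim exE conjE)
    \<comment> \<open>Zero coefficients are dropped because \<open>regular_relation\<close> asks for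
      invertible ones.\<close>
    define L' where "L' = {es \<in> L. c es \<noteq> 0}"
    define p where "p = (\<Sum>es\<in>L'. Poly_Mapping.single 0 (c es) * power_prod t fs es)"
    have const_in: "Poly_Mapping.single 0 a \<in> carrier (poly_ring V)" for a :: 'k
      by (auto simp: poly_ring_def)
    have p: "p \<in> carrier (poly_ring V)"
      unfolding p_def by (intro S.sum_closed S.mult_closed const_in S.power_prod_closed fs)
    have lookup_p: "Poly_Mapping.lookup p m = (\<Sum>es\<in>L. c es * Poly_Mapping.lookup (power_prod t fs es) m)" for m
      unfolding p_def lookup_sum lookup_const_mult
      using L by (intro sum.mono_neutral_left) (auto simp: L'_def)
    have "p * h \<in> J"
    proof (rule mult_in_ideal_if_involves[OF J h(2) p])
      fix m assume m: "m \<in> Poly_Mapping.keys p"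
      then have nz: "(\<Sum>es\<in>L. c es * Poly_Mapping.lookup (power_prod t fs es) m) \<noteq> 0"
        by (simp add: in_keys_iff lookup_p)
      then obtain es where es: "es \<in> L" "Poly_Mapping.lookup (power_prod t fs es) m \<noteq> 0"
        by (metis (no_types, lifting) mult_zero_right sum.neutral)
      have "high (length fs * (D * (t * e))) (power_prod t fs es)"
        using es by (intro high_power_prod e) (auto simp: L_def)
      then have "mdeg m \<le> E" using es fs by (auto simp: high_def E_def in_keys_iff)
      moreover have "m \<notin> M" using nz c by auto
      ultimately show "\<exists>x\<in>Poly_Mapping.keys m. fst x \<notin> U" by (force simp: M_def X_def)
    qed
    have "h \<in> S.exts J (map (\<lambda>x. x ^ t) fs)"
    proof (rule S.regular_relation[OF J fs(1) reg])
      show "finite L'" "L' \<noteq> {}" using L c by (auto simp: L'_def)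
      show "length es = length fs" if "es \<in> L'" for es using that fs by (auto simp: L'_def L_def)
      show "(\<Sum>es\<in>L'. Poly_Mapping.single 0 (c es) * power_prod t fs es) * h \<in> J"
        using \<open>p * h \<in> J\<close> by (simp add: p_def)
      fix es assume "es \<in> L'"
      then have "Poly_Mapping.single 0 (inverse (c es)) * Poly_Mapping.single 0 (c es) = (1 :: ('v,'k) mpoly)"
        by (simp add: L'_def mult_single)
      then show "Poly_Mapping.single 0 (c es) \<in> carrier (poly_ring V) \<and>
          (\<exists>d\<in>carrier (poly_ring V). d * Poly_Mapping.single 0 (c es) = 1)"
        using const_in by blast
    qed (use h t_def in auto)
    \<comment> \<open>\<open>K\<close> contains \<open>J\<close> and all \<open>f i ^ t\<close>.
      Since \<open>h\<close> has degree below \<open>t\<close>, membership in \<open>K\<close>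
      forces every monomial of \<open>h\<close> to involve a variable outside \<open>U\<close>,
      where \<open>g\<close> vanishes.\<close>
    define K where "K = {q \<in> carrier (poly_ring V) :: ('v,'k) mpoly set. \<forall>m\<in>Poly_Mapping.keys q.
        (\<exists>x\<in>Poly_Mapping.keys m. fst x \<notin> U) \<or> t \<le> mdeg m}"
    have "S.is_ideal K"
      unfolding K_def by (rule monomial_ideal) (auto simp: mdeg_add in_keys_iff lookup_add)
    moreover have "J \<subseteq> K" using J_involves S.is_idealD(1)[OF J] by (auto simp: K_def)
    moreover have "set (map (\<lambda>x. x ^ t) fs) \<subseteq> K"
    proof -
      have "f i ^ t \<in> K" if "i < r" for i
        using low_power[OF f(2)[OF that], of t] f(1)[OF that] by (auto simp: K_def low_def)
      then show ?thesis by (auto simp: fs_def)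
    qed
    ultimately have "S.exts J (map (\<lambda>x. x ^ t) fs) \<subseteq> K" by (rule S.exts_minimal)
    with \<open>h \<in> S.exts J _\<close> have "h \<in> K" by (rule rev_subsetD)
    have "psubst g h = 0"
      unfolding psubst_def
    proof (rule sum.neutral, rule ballI)
      fix m assume m: "m \<in> Poly_Mapping.keys h"
      then have "mdeg m < t" using d0 by (auto simp: high_def t_def)
      then obtain x where x: "x \<in> Poly_Mapping.keys m" "fst x \<notin> U"
        using \<open>h \<in> K\<close> m by (auto simp: K_def)
      then have "g x ^ Poly_Mapping.lookup m x = 0" using g by (simp add: in_keys_iff)
      then have "(\<Prod>x\<in>Poly_Mapping.keys m. g x ^ Poly_Mapping.lookup m x) = 0"
        using x by (intro prod_zero) auto
      then show "Poly_Mapping.single 0 (Poly_Mapping.lookup h m) *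
          (\<Prod>x\<in>Poly_Mapping.keys m. g x ^ Poly_Mapping.lookup m x) = 0" by simp
    qed
    then show False using g by simp
  qed
qed

text \<open>Independence of \<open>U\<close> puts the ideal inside the prime of the variables
  outside \<open>U\<close>, and the two neighbours make this prime multiply \<open>h\<close> into
  the ideal. This gives depth at most \<open>2 * card U\<close>, while \<open>W\<close> gives
  dimension at least \<open>card W + 1\<close>. The finite set \<open>W\<close> is separate from
  \<open>V\<close> so that \<open>V\<close> may be infinite.\<close>

lemma not_cohen_macaulay_if_small_independent_side:
  fixes V :: "'v set"
  assumes U: "finite U" "U \<subseteq> V"
    and W: "finite W" "W \<subseteq> V" "W \<noteq> {}" "2 * card U \<le> card W"
    and indep: "\<And>u v. E u v \<Longrightarrow> u \<notin> U \<or> v \<notin> U"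
    and nbrs: "\<And>v. v \<in> V - U \<Longrightarrow> \<exists>i j. i \<in> U \<and> j \<in> U \<and> i \<noteq> j \<and> E v i \<and> E v j"
  shows "\<not> cohen_macaulay_quot V (binomial_edge_ideal V E :: ('v,'k::field) mpoly set)"
proof -
  interpret S: subring_set "carrier (poly_ring V) :: ('v,'k) mpoly set" by (rule subring_poly_ring)
  let ?J = "binomial_edge_ideal V E :: ('v,'k) mpoly set"
  let ?\<Delta> = "\<lambda>u v. var_a u * var_b v - var_a v * var_b u :: ('v,'k) mpoly"
  define G where "G = {?\<Delta> u v | u v. u \<in> V \<and> v \<in> V \<and> E u v}"
  have J_eq: "?J = S.gen G"
    unfolding binomial_edge_ideal_def S.gen_def G_def poly_ring_eq_as_ring[symmetric] ..
  have G: "G \<subseteq> carrier (poly_ring V)" by (auto simp: G_def intro!: minor_in_poly_ring)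
  have J: "S.is_ideal ?J" unfolding J_eq using G by (rule S.gen_ideal)
  have edge_in: "?\<Delta> u v \<in> ?J" if "E u v" "u \<in> V" "v \<in> V" for u v
    unfolding J_eq using S.gen_superset[OF G] that by (auto simp: G_def)
  define Q where "Q = {p \<in> carrier (poly_ring V) :: ('v,'k) mpoly set.
      \<forall>m\<in>Poly_Mapping.keys p. \<exists>x\<in>Poly_Mapping.keys m. fst x \<notin> U}"
  have Q: "S.is_ideal Q"
    unfolding Q_def by (rule monomial_ideal) (auto simp: in_keys_iff lookup_add)
  have pvar_Q: "pvar (v, s) \<in> Q" if "v \<in> V" "v \<notin> U" for v s
    using that by (auto simp: Q_def pvar_def poly_ring_def)
  have "G \<subseteq> Q"
  proof
    fix p assume "p \<in> G"
    then obtain u v where uv: "p = ?\<Delta> u v" "u \<in> V" "v \<in> V" "E u v" by (auto simp: G_def)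
    then consider "u \<notin> U" | "v \<notin> U" using indep by blast
    then show "p \<in> Q"
    proof cases
      case 1
      then have "var_b v * var_a u - var_a v * var_b u \<in> Q"
        using uv pvar_Q vars_in_poly_ring[of v V]
        by (intro S.is_idealD(4,6)[OF Q]) (auto simp: var_a_def var_b_def)
      then show ?thesis using uv by (simp add: mult.commute)
    next
      case 2
      then have "var_a u * var_b v - var_b u * var_a v \<in> Q"
        using uv pvar_Q vars_in_poly_ring[of u V]
        by (intro S.is_idealD(4,6)[OF Q]) (auto simp: var_a_def var_b_def)
      then show ?thesis using uv by (simp add: mult.commute)
    qed
  qed
  then have "?J \<subseteq> Q" unfolding J_eq by (rule S.gen_minimal[OF Q])
  \<comment> \<open>One \<open>h\<close> must serve all vertices outside \<open>U\<close>, whose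
    neighbour pairs differ; hence the product over all ordered pairs.\<close>
  define h where "h = (\<Prod>(i, j) \<in> {(i, j). i \<in> U \<and> j \<in> U \<and> i \<noteq> j}. ?\<Delta> i j)"
  have pairs: "finite {(i, j). i \<in> U \<and> j \<in> U \<and> i \<noteq> j}" (is "finite ?P")
    by (rule finite_subset[of _ "U \<times> U"]) (use U in auto)
  have h: "h \<in> carrier (poly_ring V)"
    unfolding h_def using U by (intro S.prod_closed) (auto intro!: minor_in_poly_ring)
  obtain idx where bij: "bij_betw idx U {..<card U}" using ex_index[OF U(1)] .
  \<comment> \<open>With a_i sent to 1 and b_i to y_i, each minor becomes y_j - y_i, so the image of
    \<open>h\<close> is a nonzero product of Vandermonde type.\<close>
  define g :: "'v \<times> bool \<Rightarrow> (nat \<Rightarrow>\<^sub>0 nat) \<Rightarrow>\<^sub>0 'k" where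
    "g x = (if fst x \<notin> U then 0 else if snd x then 1 else pvar (idx (fst x)))" for x
  have "psubst g (?\<Delta> i j) \<noteq> 0" if "i \<in> U" "j \<in> U" "i \<noteq> j" for i j
  proof -
    have "idx i \<noteq> idx j" using bij that by (auto simp: bij_betw_def inj_on_def)
    then have "(pvar (idx j) :: (nat \<Rightarrow>\<^sub>0 nat) \<Rightarrow>\<^sub>0 'k) \<noteq> pvar (idx i)" using pvar_inj by fastforce
    then show ?thesis
      using that by (simp add: var_a_def var_b_def psubst_diff psubst_mult g_def)
  qed
  then have "psubst g h \<noteq> 0"
    unfolding h_def psubst_prod using pairs by (auto simp: prod_zero_iff)
  moreover have "pvar (v, s) * h \<in> ?J" if v: "v \<in> V - U" for v s
  proof -
    obtain i j where ij: "i \<in> U" "j \<in> U" "i \<noteq> j" "E v i" "E v j" using nbrs[OF v] by blast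
    have ijV: "i \<in> V" "j \<in> V" "v \<in> V" using ij U v by auto
    have "pvar (i, s) * ?\<Delta> v j - pvar (j, s) * ?\<Delta> v i \<in> ?J"
      using ij ijV by (intro S.is_idealD(4,6)[OF J] edge_in pvar_in_poly_ring) auto
    \<comment> \<open>Expansion of the vanishing 3 by 3 determinant with columns v, i, j and rows a,
      b and a repeated row, a or b according to \<open>s\<close>.\<close>
    also have "pvar (i, s) * ?\<Delta> v j - pvar (j, s) * ?\<Delta> v i = pvar (v, s) * ?\<Delta> i j"
      by (cases s) (simp_all add: var_a_def var_b_def algebra_simps)
    finally have "pvar (v, s) * ?\<Delta> i j \<in> ?J" .
    moreover have "(\<Prod>(i, j)\<in>?P - {(i, j)}. ?\<Delta> i j) \<in> carrier (poly_ring V)"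
      using U by (intro S.prod_closed) (auto intro!: minor_in_poly_ring)
    ultimately have "(\<Prod>(i, j)\<in>?P - {(i, j)}. ?\<Delta> i j) * (pvar (v, s) * ?\<Delta> i j) \<in> ?J"
      by (rule S.is_idealD(4)[OF J, rotated])
    moreover have "h = ?\<Delta> i j * (\<Prod>(i, j)\<in>?P - {(i, j)}. ?\<Delta> i j)"
      unfolding h_def using prod.remove[OF pairs, of "(i, j)" "\<lambda>(i, j). ?\<Delta> i j"] ij by simp
    ultimately show ?thesis by (simp only: mult_ac)
  qed
  ultimately have "depth_quot (poly_ring V) (irrelevant_ideal V) ?J \<le> enat (2 * card U)"
  proof (intro depth_quot_le[where h = h and g = g])
    show "\<exists>x\<in>Poly_Mapping.keys m. fst x \<notin> U" if "p \<in> ?J" "m \<in> Poly_Mapping.keys p" for p m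
      using \<open>?J \<subseteq> Q\<close> that by (auto simp: Q_def)
  qed (use U J h in \<open>simp_all add: g_def\<close>)
  also have "\<dots> < enat (card W + 1)" using W by simp
  also have "\<dots> \<le> krull_dim_quot (poly_ring V) ?J"
    using W by (intro krull_dim_binomial_edge_ideal_ge)
  finally show ?thesis by (simp add: cohen_macaulay_quot_def)
qed

section \<open>The Levi graph\<close>

lemma cdot_3: "cdot x y = x $ 1 * y $ 1 + x $ 2 * y $ 2 + x $ 3 * y $ 3"
  by (simp add: cdot_def sum_3)

lemma cdot_commute: "cdot x y = cdot y x"
  by (simp add: cdot_3 mult.commute)

lemma cdot_combination: "cdot (x *s u + y *s v) w = x * cdot u w + y * cdot v w"
  by (simp add: cdot_3 algebra_simps)

lemma cdot_matrix_symmetric: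
  assumes "transpose A = A"
  shows "cdot x (A *v y) = cdot y (A *v x)"
proof -
  have A: "A $ i $ j = A $ j $ i" for i j
    using arg_cong[OF assms, of "\<lambda>B. B $ i $ j"] by (simp add: transpose_def)
  show ?thesis
    by (simp add: cdot_3 matrix_vector_mult_def sum_3 A[of 2 1] A[of 3 1] A[of 3 2] algebra_simps)
qed

lemma matrix_combination: "A *v (x *s u + y *s v) = x *s (A *v u) + y *s (A *v v)"
  for A :: "complex^3^3"
  by (simp add: matrix_vector_right_distrib vector_scalar_commute)

text \<open>The basis of the line consists, up to sign, of cross products of \<open>l\<close> with
  the two unit vectors other than that of a nonzero coordinate. The last clause detects tangency: a
  gradient orthogonal to both is proportional to \<open>l\<close>.\<close>

lemma line_parametrization:
  fixes l :: "complex^3"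
  assumes "l \<noteq> 0"
  obtains u v where "cdot l u = 0" "cdot l v = 0"
    and "\<And>x y. x *s u + y *s v = 0 \<Longrightarrow> x = 0 \<and> y = 0"
    and "\<And>w. cdot u w = 0 \<Longrightarrow> cdot v w = 0 \<Longrightarrow> \<exists>c. w = c *s l"
proof -
  consider "l $ 1 \<noteq> 0" | "l $ 2 \<noteq> 0" | "l $ 3 \<noteq> 0"
    using assms by (auto simp: vec_eq_iff forall_3)
  then show thesis
  proof cases
    case 1
    show thesis
    proof (rule that[of "vector [- l $ 2, l $ 1, 0]" "vector [- l $ 3, 0, l $ 1]"])
      fix w assume "cdot (vector [- l $ 2, l $ 1, 0]) w = 0" "cdot (vector [- l $ 3, 0, l $ 1]) w = 0"
      then have "w = (w $ 1 / l $ 1) *s l"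
        using 1 by (simp add: vec_eq_iff forall_3 cdot_3 field_simps)
      then show "\<exists>c. w = c *s l" ..
    qed (use 1 in \<open>simp_all add: cdot_3 vec_eq_iff forall_3\<close>)
  next
    case 2
    show thesis
    proof (rule that[of "vector [l $ 2, - l $ 1, 0]" "vector [0, - l $ 3, l $ 2]"])
      fix w assume "cdot (vector [l $ 2, - l $ 1, 0]) w = 0" "cdot (vector [0, - l $ 3, l $ 2]) w = 0"
      then have "w = (w $ 2 / l $ 2) *s l"
        using 2 by (simp add: vec_eq_iff forall_3 cdot_3 field_simps)
      then show "\<exists>c. w = c *s l" ..
    qed (use 2 in \<open>simp_all add: cdot_3 vec_eq_iff forall_3\<close>)
  next
    case 3
    show thesis
    proof (rule that[of "vector [l $ 3, 0, - l $ 1]" "vector [0, l $ 3, - l $ 2]"])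
      fix w assume "cdot (vector [l $ 3, 0, - l $ 1]) w = 0" "cdot (vector [0, l $ 3, - l $ 2]) w = 0"
      then have "w = (w $ 3 / l $ 3) *s l"
        using 3 by (simp add: vec_eq_iff forall_3 cdot_3 field_simps)
      then show "\<exists>c. w = c *s l" ..
    qed (use 3 in \<open>simp_all add: cdot_3 vec_eq_iff forall_3\<close>)
  qed
qed

text \<open>The form is \<alpha> x x + 2 \<beta> x y + \<gamma> y y. For \<alpha> nonzero its roots
  are [-\<beta> + s : \<alpha>] and [-\<beta> - s : \<alpha>], where s is a square root of \<beta>
  \<beta> - \<alpha> \<gamma>; if s vanished, (-\<beta>, \<alpha>) would be a kernel vector.\<close>

lemma nondegenerate_binary_form_roots:
  fixes \<alpha> \<beta> \<gamma> :: complex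
  assumes nondeg: "\<And>x y. \<alpha> * x + \<beta> * y = 0 \<Longrightarrow> \<beta> * x + \<gamma> * y = 0 \<Longrightarrow> x = 0 \<and> y = 0"
  obtains x y x' y' where "x * (\<alpha> * x + \<beta> * y) + y * (\<beta> * x + \<gamma> * y) = 0"
    "x' * (\<alpha> * x' + \<beta> * y') + y' * (\<beta> * x' + \<gamma> * y') = 0" "x * y' \<noteq> x' * y"
proof (cases "\<alpha> = 0")
  case True
  then have "\<beta> \<noteq> 0" using nondeg[of 1 0] by auto
  then show thesis
    \<comment> \<open>With \<alpha> = 0 the form is y (2 \<beta> x + \<gamma> y), and these are the
      zeros of its two factors.\<close>
    using True by (intro that[of 1 0 \<gamma> "- 2 * \<beta>"]) (auto simp: algebra_simps)
next
  case False
  define s where "s = csqrt (\<beta>\<^sup>2 - \<alpha> * \<gamma>)"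
  have s2: "s * s = \<beta> * \<beta> - \<alpha> * \<gamma>" using power2_csqrt[of "\<beta>\<^sup>2 - \<alpha> * \<gamma>"] by (simp add: s_def power2_eq_square)
  have s: "s \<noteq> 0"
  proof
    assume "s = 0"
    then have "\<beta> * (- \<beta>) + \<gamma> * \<alpha> = 0" using s2 by (simp add: algebra_simps)
    then show False using nondeg[of "- \<beta>" \<alpha>] False by (simp add: algebra_simps)
  qed
  have root: "(- \<beta> + r) * (\<alpha> * (- \<beta> + r) + \<beta> * \<alpha>) + \<alpha> * (\<beta> * (- \<beta> + r) + \<gamma> * \<alpha>) = 0"
    if "r * r = \<beta> * \<beta> - \<alpha> * \<gamma>" for r
  proof -
    have "(- \<beta> + r) * (\<alpha> * (- \<beta> + r) + \<beta> * \<alpha>) + \<alpha> * (\<beta> * (- \<beta> + r) + \<gamma> * \<alpha>)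
        = \<alpha> * (r * r - \<beta> * \<beta> + \<alpha> * \<gamma>)" by (simp add: algebra_simps)
    then show ?thesis using that by simp
  qed
  show thesis
  proof (rule that[OF root[OF s2] root[of "- s"]])
    show "- s * - s = \<beta> * \<beta> - \<alpha> * \<gamma>" using s2 by simp
    show "(- \<beta> + s) * \<alpha> \<noteq> (- \<beta> + - s) * \<alpha>" using s False by (simp add: eq_neg_iff_add_eq_0)
  qed
qed

text \<open>The conic restricts to a binary quadratic form on the line. A kernel vector of this form
  would be a point of both curves whose conic gradient is proportional to the line, a tangency that
  the arrangement excludes. So the form has two distinct roots.\<close>

lemma line_meets_conic_twice:
  assumes arr: "conic_line_arrangement n k L A" and i: "i < n" and j: "n \<le> j" "j < n + k"
  obtains p q where "p \<noteq> 0" "q \<noteq> 0" "proj_pt p \<noteq> proj_pt q"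
    "curve_eq n L A i p" "curve_eq n L A j p" "curve_eq n L A i q" "curve_eq n L A j q"
proof -
  have l: "L i \<noteq> 0" using arr i by (simp add: conic_line_arrangement_def)
  have "smooth_conic (A (j - n))" using arr j by (simp add: conic_line_arrangement_def)
  then have sym: "transpose (A (j - n)) = A (j - n)" by (simp add: smooth_conic_def)
  have transversal: "A (j - n) *v p \<noteq> c *s L i"
    if "p \<noteq> 0" "cdot (L i) p = 0" "cdot p (A (j - n) *v p) = 0" for p c
  proof -
    have "\<forall>p i j. p \<noteq> 0 \<and> i < n+k \<and> j < n+k \<and> i \<noteq> j \<and> curve_eq n L A i p \<and> curve_eq n L A j p
        \<longrightarrow> (\<forall>c. curve_grad n L A i p \<noteq> c *s curve_grad n L A j p)"
      using arr unfolding conic_line_arrangement_def by blast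
    \<comment> \<open>The conic comes first, so that its gradient is compared with multiples of
      \<open>L i\<close>.\<close>
    from this[rule_format, of p j i c] show ?thesis
      using that i j by (simp add: curve_eq_def curve_grad_def)
  qed
  obtain u v where uv: "cdot (L i) u = 0" "cdot (L i) v = 0"
    "\<And>x y. x *s u + y *s v = 0 \<Longrightarrow> x = 0 \<and> y = 0"
    "\<And>w. cdot u w = 0 \<Longrightarrow> cdot v w = 0 \<Longrightarrow> \<exists>c. w = c *s L i"
    using line_parametrization[OF l] by metis
  define \<alpha> \<beta> \<gamma> where "\<alpha> = cdot u (A (j - n) *v u)" and "\<beta> = cdot u (A (j - n) *v v)"
    and "\<gamma> = cdot v (A (j - n) *v v)"
  have \<beta>: "cdot v (A (j - n) *v u) = \<beta>" unfolding \<beta>_def by (rule cdot_matrix_symmetric[OF sym])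
  have pair: "cdot w (A (j - n) *v (x *s u + y *s v)) = x * cdot w (A (j - n) *v u) + y * cdot w (A (j - n) *v v)"
    for w x y
    unfolding matrix_combination by (subst (1 2 3) cdot_commute) (rule cdot_combination)
  have form: "cdot (x *s u + y *s v) (A (j - n) *v (x *s u + y *s v)) =
      x * (\<alpha> * x + \<beta> * y) + y * (\<beta> * x + \<gamma> * y)" for x y
    unfolding cdot_combination pair \<beta> \<alpha>_def[symmetric] \<beta>_def[symmetric] \<gamma>_def[symmetric]
    by (simp add: mult.commute)
  have on_line: "cdot (L i) (x *s u + y *s v) = 0" for x y
    using uv(1,2) cdot_combination[of x u y v "L i"] by (simp add: cdot_commute[of "L i"])
  have nondeg: "x = 0 \<and> y = 0" if xy: "\<alpha> * x + \<beta> * y = 0" "\<beta> * x + \<gamma> * y = 0" for x y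
  proof (rule ccontr)
    assume "\<not> (x = 0 \<and> y = 0)"
    then have nz: "x *s u + y *s v \<noteq> 0" using uv(3) by blast
    have "cdot u (A (j - n) *v (x *s u + y *s v)) = 0" "cdot v (A (j - n) *v (x *s u + y *s v)) = 0"
      using xy unfolding pair \<beta> \<alpha>_def[symmetric] \<beta>_def[symmetric] \<gamma>_def[symmetric]
      by (simp_all add: mult.commute)
    then obtain c where "A (j - n) *v (x *s u + y *s v) = c *s L i" using uv(4) by blast
    moreover have "cdot (x *s u + y *s v) (A (j - n) *v (x *s u + y *s v)) = 0"
      unfolding form xy by simp
    ultimately show False using transversal[OF nz on_line] by blast
  qed
  obtain x y x' y' where roots: "x * (\<alpha> * x + \<beta> * y) + y * (\<beta> * x + \<gamma> * y) = 0"
    "x' * (\<alpha> * x' + \<beta> * y') + y' * (\<beta> * x' + \<gamma> * y') = 0" "x * y' \<noteq> x' * y"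
    using nondegenerate_binary_form_roots[OF nondeg] by metis
  let ?p = "x *s u + y *s v" and ?q = "x' *s u + y' *s v"
  show thesis
  proof (rule that[of ?p ?q])
    show "?p \<noteq> 0" "?q \<noteq> 0" using uv(3)[of x y] uv(3)[of x' y'] roots(3) by auto
    show "curve_eq n L A i ?p" "curve_eq n L A i ?q" using i on_line by (simp_all add: curve_eq_def)
    show "curve_eq n L A j ?p" "curve_eq n L A j ?q" using j roots by (simp_all add: curve_eq_def form)
    show "proj_pt ?p \<noteq> proj_pt ?q"
    proof
      assume eq: "proj_pt ?p = proj_pt ?q"
      have "?p \<in> proj_pt ?p" unfolding proj_pt_def by (intro CollectI exI[of _ 1]) simp
      then obtain c where "?p = c *s ?q" unfolding eq by (auto simp: proj_pt_def)
      then have "(x - c * x') *s u + (y - c * y') *s v = 0"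
        by (simp add: vec_eq_iff algebra_simps)
      then have "x = c * x'" "y = c * y'" using uv(3)[of "x - c * x'" "y - c * y'"] by simp_all
      then show False using roots(3) by simp
    qed
  qed
qed

section \<open>Incidences between points and curves\<close>

lemma self_in_proj_pt: "p \<in> proj_pt p"
  unfolding proj_pt_def by (intro CollectI exI[of _ 1]) simp

lemma sing_pointsI:
  assumes "p \<noteq> 0" "i < n + k" "j < n + k" "i \<noteq> j" "curve_eq n L A i p" "curve_eq n L A j p"
  shows "proj_pt p \<in> sing_points n k L A"
  using assms unfolding sing_points_def by blast

text \<open>Each curve is paired with one of the other kind: a line with the conic of index
  \<open>n\<close>, a conic with the line of index \<open>0\<close>. This is where both kinds must
  occur.\<close>

lemma curve_has_two_sing_points:
  assumes arr: "conic_line_arrangement n k L A" and nk: "n \<ge> 1" "k \<ge> 1" and c: "c < n + k"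
  obtains P Q where "P \<noteq> Q" "levi_edge n k L A (Inr c) (Inl P)" "levi_edge n k L A (Inr c) (Inl Q)"
proof -
  obtain i j where ij: "i < n" "n \<le> j" "j < n + k" "c = i \<or> c = j"
  proof (cases "c < n")
    case True
    then show thesis using nk by (intro that[of c n]) auto
  next
    case False
    then show thesis using nk c by (intro that[of 0 c]) auto
  qed
  obtain p q where pq: "p \<noteq> 0" "q \<noteq> 0" "proj_pt p \<noteq> proj_pt q"
    "curve_eq n L A i p" "curve_eq n L A j p" "curve_eq n L A i q" "curve_eq n L A j q"
    using line_meets_conic_twice[OF arr ij(1-3)] by blast
  have sing: "proj_pt p \<in> sing_points n k L A" "proj_pt q \<in> sing_points n k L A"
    using ij pq by (auto intro!: sing_pointsI[of _ i _ _ j])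
  have "levi_edge n k L A (Inr c) (Inl (proj_pt p))" "levi_edge n k L A (Inr c) (Inl (proj_pt q))"
    unfolding levi_edge_def using sing ij pq c self_in_proj_pt[of p] self_in_proj_pt[of q] by blast+
  with pq show thesis using that by blast
qed

lemma sing_point_has_two_curves:
  assumes "P \<in> sing_points n k L A"
  obtains i j where "i < n + k" "j < n + k" "i \<noteq> j"
    "levi_edge n k L A (Inl P) (Inr i)" "levi_edge n k L A (Inl P) (Inr j)"
proof -
  obtain p i j where p: "P = proj_pt p" "i < n + k" "j < n + k" "i \<noteq> j"
    "curve_eq n L A i p" "curve_eq n L A j p"
    using assms unfolding sing_points_def by blast
  then have "levi_edge n k L A (Inl P) (Inr i)" "levi_edge n k L A (Inl P) (Inr j)"
    unfolding levi_edge_def using assms self_in_proj_pt[of p] by blast+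
  with p show thesis using that by blast
qed

theorem theorem4p9:
  fixes n k :: nat and L :: "nat \<Rightarrow> complex^3" and A :: "nat \<Rightarrow> complex^3^3"
  assumes "conic_line_arrangement n k L A"
    and "n \<ge> 1" and "k \<ge> 1"
  shows "\<not> cohen_macaulay_quot (levi_vertices n k L A)
            (binomial_edge_ideal (levi_vertices n k L A) (levi_edge n k L A) :: (levi_vertex, 'k::field) mpoly set)"
proof -
  let ?m = "n + k" and ?S = "sing_points n k L A" and ?V = "levi_vertices n k L A"
  let ?curves = "Inr ` {..<?m} :: levi_vertex set"
  have card_curves: "card ?curves = ?m" "finite ?curves" by (simp_all add: card_image)
  have bipartite: "(u \<in> Inl ` ?S \<longleftrightarrow> v \<notin> Inl ` ?S) \<and> (u \<in> ?curves \<longleftrightarrow> v \<notin> ?curves)"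
    if "levi_edge n k L A u v" for u v
    using that unfolding levi_edge_def by auto
  show ?thesis
  \<comment> \<open>\<open>U\<close> is the smaller side. With fewer points than curves,
    \<open>W\<close> is the whole vertex set; otherwise \<open>W\<close> consists of the curves and
    equally many points.\<close>
  proof (cases "finite ?S \<and> card ?S < ?m")
    case True
    let ?U = "Inl ` ?S :: levi_vertex set"
    have fin: "finite ?U" "card ?U = card ?S" using True by (auto simp: card_image)
    have card_V: "card ?V = card ?S + ?m" "finite ?V"
      using card_Un_disjoint[of ?U ?curves] fin card_curves by (auto simp: levi_vertices_def)
    show ?thesis
    proof (rule not_cohen_macaulay_if_small_independent_side[where U = ?U and W = ?V])
      show "finite ?U" "finite ?V" "2 * card ?U \<le> card ?V" using fin card_V True by simp_all
      show "?V \<noteq> {}" using assms(2) by (auto simp: levi_vertices_def lessThan_empty_iff)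
      show "u \<notin> ?U \<or> v \<notin> ?U" if "levi_edge n k L A u v" for u v
        using bipartite[OF that] by blast
      fix v assume "v \<in> ?V - ?U"
      then obtain c where c: "v = Inr c" "c < ?m" by (auto simp: levi_vertices_def)
      obtain P Q where PQ: "P \<noteq> Q" "levi_edge n k L A v (Inl P)" "levi_edge n k L A v (Inl Q)"
        using curve_has_two_sing_points[OF assms c(2)] c(1) by metis
      then have "Inl P \<in> ?U" "Inl Q \<in> ?U" unfolding levi_edge_def by auto
      with PQ show "\<exists>i j. i \<in> ?U \<and> j \<in> ?U \<and> i \<noteq> j \<and> levi_edge n k L A v i \<and> levi_edge n k L A v j"
        by (metis Inl_inject)
    qed (auto simp: levi_vertices_def)
  next
    case False
    \<comment> \<open>Exactly \<open>?m\<close> points give \<open>card ?W = 2 * ?m\<close>, just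
      enough for \<open>2 * card U \<le> card W\<close>, whether \<open>?S\<close> is finite or
      infinite.\<close>
    obtain B where B: "finite B" "B \<subseteq> ?S" "card B = ?m"
    proof (cases "finite ?S")
      case True
      then show thesis
        using False obtain_subset_with_card_n[of ?m ?S] that finite_subset by (metis not_less)
    next
      case False
      then show thesis using infinite_arbitrarily_large[of ?S ?m] that by blast
    qed
    let ?W = "Inl ` B \<union> ?curves :: levi_vertex set"
    have card_W: "card ?W = 2 * ?m"
      using B card_curves by (subst card_Un_disjoint) (auto simp: card_image)
    show ?thesis
    proof (rule not_cohen_macaulay_if_small_independent_side[where U = ?curves and W = ?W])
      show "u \<notin> ?curves \<or> v \<notin> ?curves" if "levi_edge n k L A u v" for u v
        using bipartite[OF that] by blast
      fix v assume "v \<in> ?V - ?curves"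
      then obtain P where P: "v = Inl P" "P \<in> ?S" by (auto simp: levi_vertices_def)
      obtain i j where "i < ?m" "j < ?m" "i \<noteq> j"
        "levi_edge n k L A v (Inr i)" "levi_edge n k L A v (Inr j)"
        using sing_point_has_two_curves[OF P(2)] P(1) by metis
      then show "\<exists>i j. i \<in> ?curves \<and> j \<in> ?curves \<and> i \<noteq> j \<and> levi_edge n k L A v i \<and> levi_edge n k L A v j"
        by (metis Inr_inject imageI lessThan_iff)
    qed (use B card_W card_curves assms(2) in \<open>auto simp: levi_vertices_def lessThan_empty_iff\<close>)
  qed
qed

end
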